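(* Let $\lambda$ be an infinite cardinal, and suppose that at least one of the following holds: (i) $\lambda<\omega_\omega$; (ii) $2^{\omega}<\lambda$, and for each cardinal $\mu\le\lambda$ with $\omega=\operatorname{cf}(\mu)<\mu$ both $\mu^{\omega}=\mu^+$ and $\Box_\mu$ hold. Then there is an $\omega$-homogeneous and $\omega$-intransitive permutation group on $\lambda$.
   Context: A permutation group on a set $A$ is a subgroup of the group $S(A)$ of all permutations of $A$. For a cardinal $\kappa$, $[A]^{\kappa}$ is the set of subsets of $A$ of cardinality $\kappa$. Functions are identified with their graphs (sets of ordered pairs). A permutation group $G$ on $A$ is $\kappa$-homogeneous iff for all $X,Y\in[A]^{\kappa}$ with $|A\setminus X|=|A\setminus Y|=|A|$ there is $g\in G$ with $g[X]=Y$. Given a family $\mathcal G$ of functions, a function $y$ is $\mathcal G$-large iff $|y\setminus\bigcup\mathcal H|=|y|$ for each finite $\mathcal H\subseteq\mathcal G$. A permutation group $G$ on $A$ is $\kappa$-intransitive iff there is a $G$-large injective function $y$ with $\operatorname{dom}(y)\cup\operatorname{ran}(y)\in[A]^{\kappa}$ and $|A\setminus\operatorname{dom}(y)|=|A\setminus\operatorname{ran}(y)|=|A|$. $\Box_\mu$ denotes Jensen's square principle at $\mu$. *)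

theory Defs
  imports "HOL-Algebra.Bij"
begin

unbundle cardinal_syntax

section \<open>Permutation groups\<close>

definition permutation_group :: "'a set \<Rightarrow> ('a \<Rightarrow> 'a) set \<Rightarrow> bool" where
  "permutation_group A G \<longleftrightarrow> subgroup G (BijGroup A)"

definition subsets_of_card :: "'a set \<Rightarrow> 'k rel \<Rightarrow> 'a set set" where
  "subsets_of_card A \<kappa> = {X. X \<subseteq> A \<and> |X| =o \<kappa>}"

definition homogeneous :: "'k rel \<Rightarrow> 'a set \<Rightarrow> ('a \<Rightarrow> 'a) set \<Rightarrow> bool" where
  "homogeneous \<kappa> A G \<longleftrightarrow>
     (\<forall>X \<in> subsets_of_card A \<kappa>. \<forall>Y \<in> subsets_of_card A \<kappa>.
        |A - X| =o |A| \<and> |A - Y| =o |A| \<longrightarrow> (\<exists>g \<in> G. g ` X = Y))"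

definition graph_on :: "'a set \<Rightarrow> ('a \<Rightarrow> 'a) \<Rightarrow> ('a \<times> 'a) set" where
  "graph_on A g = {(x, g x) | x. x \<in> A}"

definition large :: "('a \<times> 'a) set set \<Rightarrow> ('a \<times> 'a) set \<Rightarrow> bool" where
  "large \<G> y \<longleftrightarrow> (\<forall>\<H>. finite \<H> \<and> \<H> \<subseteq> \<G> \<longrightarrow> |y - \<Union>\<H>| =o |y| )"

text \<open>The function \<open>y\<close> below is partial, hence given by its graph.\<close>

definition intransitive :: "'k rel \<Rightarrow> 'a set \<Rightarrow> ('a \<Rightarrow> 'a) set \<Rightarrow> bool" where
  "intransitive \<kappa> A G \<longleftrightarrow>
     (\<exists>y. single_valued y \<and> single_valued (y\<inverse>) \<and> large (graph_on A ` G) y \<and>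
          Domain y \<union> Range y \<in> subsets_of_card A \<kappa> \<and>
          |A - Domain y| =o |A| \<and> |A - Range y| =o |A| )"

section \<open>Cardinals\<close>

text \<open>
  Well-orders \<open>r\<close> are reflexive relations on \<open>Field r\<close>. The element \<open>a\<close> of \<open>Field r\<close> plays the
  role of the ordinal \<open>underS r a\<close>, ordered by \<open>Restr r (underS r a)\<close>.
\<close>

text \<open>
  \<open>is_aleph n r\<close>: \<open>r\<close> is (a copy of) \<open>\<omega>\<^sub>n\<close>. No type provably carries a well-order of type
  \<open>\<omega>\<^sub>\<omega>\<close>, so \<open>r < \<omega>\<^sub>\<omega>\<close> is read through \<open>\<omega>\<^sub>\<omega> = sup \<omega>\<^sub>n\<close>. If \<open>r\<close> is infinite and equal to
  \<open>\<omega>\<^sub>m\<close> then \<open>\<omega>\<^sub>m\<^sub>+\<^sub>1\<close> is \<open>cardSuc r\<close>, so the type \<open>'a set\<close> is large enough for the bound \<open>s\<close>.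
\<close>

primrec is_aleph :: "nat \<Rightarrow> 'a rel \<Rightarrow> bool" where
  "is_aleph 0 r \<longleftrightarrow> Card_order r \<and> r =o natLeq"
| "is_aleph (Suc n) r \<longleftrightarrow> Card_order r \<and> (\<exists>s :: 'a rel. is_aleph n s \<and> r =o cardSuc s)"

definition below_aleph_omega :: "'a rel \<Rightarrow> bool" where
  "below_aleph_omega r \<longleftrightarrow> (\<exists>n. \<exists>s :: 'a set rel. is_aleph n s \<and> r <o s)"

text \<open>The library's \<open>cofinal\<close> is strict, so \<open>cf\<close> is meaningful only for limit order types.\<close>

definition cf :: "'a rel \<Rightarrow> 'a rel" where
  "cf r = |SOME X. X \<subseteq> Field r \<and> cofinal X r \<and>
                   (\<forall>Y. Y \<subseteq> Field r \<and> cofinal Y r \<longrightarrow> |X| \<le>o |Y| )|"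

section \<open>Jensen's square principle\<close>

definition unbounded_below :: "'a rel \<Rightarrow> 'a \<Rightarrow> 'a set \<Rightarrow> bool" where
  "unbounded_below r a X \<longleftrightarrow> (\<forall>b \<in> underS r a. \<exists>c \<in> X \<inter> underS r a. b \<in> underS r c)"

text \<open>In particular \<open>Lim r (Field r)\<close> is the set of limit ordinals below \<open>r\<close>, without 0.\<close>

definition Lim :: "'a rel \<Rightarrow> 'a set \<Rightarrow> 'a set" where
  "Lim r X = {a \<in> Field r. underS r a \<noteq> {} \<and> unbounded_below r a X}"

definition club_in :: "'a rel \<Rightarrow> 'a \<Rightarrow> 'a set \<Rightarrow> bool" where
  "club_in r a C \<longleftrightarrow>
     C \<subseteq> underS r a \<and> unbounded_below r a C \<and> Lim r C \<inter> underS r a \<subseteq> C"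

text \<open>
  Square at the cardinal \<open>\<mu>\<close>, with indices ranging over the limit ordinals below \<open>\<mu>\<^sup>+\<close>. As in
  Jensen's original principle, \<open>C \<alpha>\<close> has to be small only when \<open>cf \<alpha> < \<mu>\<close>; since \<open>\<mu>\<close> is a
  cardinal, \<open>|C \<alpha>| < \<mu>\<close> says the same as \<open>otp (C \<alpha>) < \<mu>\<close>.
\<close>

definition square :: "'a rel \<Rightarrow> bool" where
  "square \<mu> \<longleftrightarrow>
     (let R = cardSuc \<mu> in
      \<exists>C :: 'a set \<Rightarrow> 'a set set. \<forall>\<alpha> \<in> Lim R (Field R).
        club_in R \<alpha> (C \<alpha>) \<and>
        (\<forall>\<beta> \<in> Lim R (C \<alpha>) \<inter> underS R \<alpha>. C \<beta> = C \<alpha> \<inter> underS R \<beta>) \<and>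
        (cf (Restr R (underS R \<alpha>)) <o \<mu> \<longrightarrow> |C \<alpha>| <o \<mu>))"

end

theory Submission
  imports Defs "HOL-Library.Countable_Set" "HOL-Library.Infinite_Set"
begin

text \<open>
  Suppose each countable \<open>A \<subseteq> \<lambda>\<close> carries a finite-to-one function \<open>e\<^sub>A: A \<rightarrow> \<omega>\<close> such that \<open>e\<^sub>A\<close> and
  \<open>e\<^sub>B\<close> agree on all but finitely many points of \<open>A \<inter> B\<close>. Ordering \<open>A\<close> in type \<open>\<omega>\<close> by \<open>e\<^sub>A\<close>, the
  permutations whose restrictions to countable sets are finite unions of increasing maps form a
  group. It is \<open>\<omega>\<close>-homogeneous, because infinite subsets of a common countable set are matched by an
  increasing bijection, and a function that reverses longer and longer finite blocks is large for it.

  Such functions are built by transfinite recursion, extending families given on countably many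
  subsets of \<open>X\<close> to \<open>X\<close>, by induction on \<open>|X|\<close>. For countable \<open>X\<close> one amalgamates countably many
  functions. If \<open>|X|\<close> has uncountable cofinality, every countable subset of \<open>X\<close> lies in a proper
  initial segment. If \<open>|X|\<close> is singular of cofinality \<open>\<omega>\<close>, then \<open>\<mu>\<^sup>\<omega> = \<mu>\<^sup>+\<close> and square give sets
  \<open>Z \<alpha> n\<close> of size \<open>< \<mu>\<close>, for \<open>\<alpha> < \<mu>\<^sup>+\<close>, which absorb all countable subsets of \<open>X\<close>; at stages \<open>\<alpha>\<close> of
  uncountable cofinality the coherence of the square sequence puts every countable subset of
  \<open>Z \<alpha> n\<close> into an earlier \<open>Z \<gamma> n\<close>, so that nothing has to be chosen there.
\<close>

section \<open>Coherent families of finite-to-one functions\<close>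

text \<open>A family is a relation, so one set may carry several functions and extending a family
  never revises an earlier choice. One function per set is selected only in
  \<open>coherent_inj_exists\<close>.\<close>

definition coherent :: "('a set \<times> ('a \<Rightarrow> nat)) set \<Rightarrow> bool" where
  "coherent E \<longleftrightarrow>
     (\<forall>(A, f) \<in> E. countable A \<and> (\<forall>k. finite {x \<in> A. f x = k})) \<and>
     (\<forall>(A, f) \<in> E. \<forall>(B, g) \<in> E. finite {x \<in> A \<inter> B. f x \<noteq> g x})"

definition full :: "'a set \<Rightarrow> ('a set \<times> ('a \<Rightarrow> nat)) set \<Rightarrow> bool" where
  "full X E \<longleftrightarrow> (\<forall>A. A \<subseteq> X \<and> countable A \<longrightarrow> (\<exists>f. (A, f) \<in> E))"

text \<open>The last clause locates the new sets. In a recursion it is what bounds the trace of the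
  current family on the next set by members of earlier stages.\<close>

definition grows ::
  "('a set \<times> ('a \<Rightarrow> nat)) set \<Rightarrow> 'a set set \<Rightarrow> ('a set \<times> ('a \<Rightarrow> nat)) set \<Rightarrow> bool" where
  "grows E \<X> E' \<longleftrightarrow> E \<subseteq> E' \<and> coherent E' \<and> (\<forall>X \<in> \<X>. full X E') \<and>
     (\<forall>A f. (A, f) \<in> E' - E \<longrightarrow> (\<exists>X \<in> \<X>. A \<subseteq> X))"

text \<open>The last hypothesis on \<open>E\<close> bounds its trace on each \<open>X\<close> by countably many sets; this is
  what makes the extension possible when \<open>X\<close> is countable.\<close>

definition extendable :: "'a set set \<Rightarrow> bool" where
  "extendable \<X> \<longleftrightarrow>
     (\<forall>E \<Y>. coherent E \<and> countable \<Y> \<and> (\<forall>Y \<in> \<Y>. full Y E) \<and>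
        (\<forall>X \<in> \<X>. \<forall>A f. (A, f) \<in> E \<longrightarrow> (\<exists>Y \<in> \<Y>. A \<inter> X \<subseteq> Y)) \<longrightarrow> (\<exists>E'. grows E \<X> E'))"

lemma coherentI:
  assumes "\<And>A f. (A, f) \<in> E \<Longrightarrow> countable A"
    and "\<And>A f k. (A, f) \<in> E \<Longrightarrow> finite {x \<in> A. f x = k}"
    and "\<And>A f B g. (A, f) \<in> E \<Longrightarrow> (B, g) \<in> E \<Longrightarrow> finite {x \<in> A \<inter> B. f x \<noteq> g x}"
  shows "coherent E"
  using assms unfolding coherent_def by auto

lemma coherentD:
  assumes "coherent E" "(A, f) \<in> E"
  shows "countable A" "finite {x \<in> A. f x = k}"
    "(B, g) \<in> E \<Longrightarrow> finite {x \<in> A \<inter> B. f x \<noteq> g x}"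
  using assms unfolding coherent_def by auto

lemma coherent_Union:
  assumes coh: "\<And>E. E \<in> \<C> \<Longrightarrow> coherent E"
    and chain: "\<And>E E'. E \<in> \<C> \<Longrightarrow> E' \<in> \<C> \<Longrightarrow> E \<subseteq> E' \<or> E' \<subseteq> E"
  shows "coherent (\<Union>\<C>)"
proof (rule coherentI)
  fix A f B g assume "(A, f) \<in> \<Union>\<C>" "(B, g) \<in> \<Union>\<C>"
  then obtain E where "E \<in> \<C>" "(A, f) \<in> E" "(B, g) \<in> E"
    using chain by blast
  then show "finite {x \<in> A \<inter> B. f x \<noteq> g x}"
    using coherentD(3)[OF coh] by blast
qed (use coherentD(1,2)[OF coh] in blast)+

lemma growsD:
  assumes "grows E \<X> E'"
  shows "E \<subseteq> E'" "coherent E'" "X \<in> \<X> \<Longrightarrow> full X E'"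
    "(A, f) \<in> E' \<Longrightarrow> (A, f) \<notin> E \<Longrightarrow> \<exists>X \<in> \<X>. A \<subseteq> X"
proof -
  note * = assms[unfolded grows_def]
  show "E \<subseteq> E'" "coherent E'" using * by simp_all
  show "full X E'" if "X \<in> \<X>" using * that by simp
  show "\<exists>X \<in> \<X>. A \<subseteq> X" if "(A, f) \<in> E'" "(A, f) \<notin> E"
    using that by (intro *[THEN conjunct2, THEN conjunct2, THEN conjunct2, rule_format] DiffI)
qed

lemma growsI:
  assumes "E \<subseteq> E'" "coherent E'" "\<And>X. X \<in> \<X> \<Longrightarrow> full X E'"
    "\<And>A f. (A, f) \<in> E' \<Longrightarrow> (A, f) \<notin> E \<Longrightarrow> \<exists>X \<in> \<X>. A \<subseteq> X"
  shows "grows E \<X> E'"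
  unfolding grows_def
proof (intro conjI ballI allI impI)
  fix A f assume "(A, f) \<in> E' - E"
  then show "\<exists>X \<in> \<X>. A \<subseteq> X" using assms(4)[of A f] by simp
qed (use assms in simp_all)

lemma full_mono: "full X E \<Longrightarrow> E \<subseteq> E' \<Longrightarrow> full X E'"
  unfolding full_def by blast

lemma extendableI:
  assumes "\<And>E \<Y>. coherent E \<Longrightarrow> countable \<Y> \<Longrightarrow> (\<And>Y. Y \<in> \<Y> \<Longrightarrow> full Y E) \<Longrightarrow>
    (\<And>X A f. X \<in> \<X> \<Longrightarrow> (A, f) \<in> E \<Longrightarrow> \<exists>Y \<in> \<Y>. A \<inter> X \<subseteq> Y) \<Longrightarrow> \<exists>E'. grows E \<X> E'"
  shows "extendable \<X>"
  unfolding extendable_def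
proof (intro allI impI, elim conjE)
  fix E :: "('a set \<times> ('a \<Rightarrow> nat)) set" and \<Y>
  assume *: "coherent E" "countable \<Y>" "\<forall>Y \<in> \<Y>. full Y E"
    "\<forall>X \<in> \<X>. \<forall>A f. (A, f) \<in> E \<longrightarrow> (\<exists>Y \<in> \<Y>. A \<inter> X \<subseteq> Y)"
  show "\<exists>E'. grows E \<X> E'"
    by (rule assms[OF *(1,2) *(3)[rule_format] *(4)[rule_format]])
qed

lemma extendableD:
  assumes "extendable \<X>" "coherent E" "countable \<Y>" "\<And>Y. Y \<in> \<Y> \<Longrightarrow> full Y E"
    and "\<And>X A f. X \<in> \<X> \<Longrightarrow> (A, f) \<in> E \<Longrightarrow> \<exists>Y \<in> \<Y>. A \<inter> X \<subseteq> Y"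
  shows "\<exists>E'. grows E \<X> E'"
  by (rule assms(1)[unfolded extendable_def, THEN spec[of _ E], THEN spec[of _ \<Y>], THEN mp])
    (intro conjI ballI allI impI assms(2-5))

section \<open>Transfinite recursion on families\<close>

text \<open>Stage \<open>i\<close> extends the union of \<open>E0\<close> and all earlier stages.
  Such unions stay coherent because the stages form a chain and coherence concerns only two members
  at a time.\<close>

lemma grows_chain:
  fixes r :: "'i rel"
  assumes wo: "Well_order r" and E0: "coherent E0"
    and step: "\<And>i E. i \<in> Field r \<Longrightarrow> grows E0 (\<Union>j \<in> underS r i. \<X> j) E \<Longrightarrow> \<exists>E'. grows E (\<X> i) E'"
  shows "\<exists>E. grows E0 (\<Union>j \<in> Field r. \<X> j) E"
proof -
  interpret wo_rel r using wo by (simp add: wo_rel_def)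
  \<comment> \<open>\<open>T\<close> chooses a one-step extension; \<open>H i\<close> is the family
    after stage \<open>i\<close>, and \<open>P D\<close> below collects the stages with index in
    \<open>D\<close>.\<close>
  define T where "T i E = (SOME E'. grows E (\<X> i) E')" for i E
  define H where "H = worec (\<lambda>h i. T i (E0 \<union> \<Union>(h ` underS i)))"
  have H: "H i = T i (E0 \<union> \<Union>(H ` underS i))" for i
    unfolding H_def by (subst worec_fixpoint) (auto simp: adm_wo_def cong: image_cong)
  define P where "P D = E0 \<union> \<Union>(H ` D)" for D
  \<comment> \<open>Any initial segment \<open>D\<close> is allowed because this is used twice: for
    \<open>underS i\<close> in the induction and for the whole field at the end.\<close>
  have union: "grows E0 (\<Union>j \<in> D. \<X> j) (P D)"
    if D: "D \<subseteq> Field r" "\<And>j. j \<in> D \<Longrightarrow> underS j \<subseteq> D"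
      and IH: "\<And>j. j \<in> D \<Longrightarrow> grows E0 (\<Union>k \<in> underS j. \<X> k) (P (underS j))" for D
  proof -
    have HD: "grows (P (underS j)) (\<X> j) (H j)" if "j \<in> D" for j
    proof -
      have "\<exists>E'. grows (P (underS j)) (\<X> j) E'"
        using step IH D that by blast
      then show ?thesis
        using H[of j] unfolding T_def P_def by (metis someI_ex)
    qed
    have le: "H j \<subseteq> H k" if "j \<in> underS k" "k \<in> D" for j k
      using growsD(1)[OF HD[OF that(2)]] that(1) unfolding P_def by blast
    have E0H: "E0 \<subseteq> H j" if "j \<in> D" for j
      using growsD(1)[OF HD[OF that]] unfolding P_def by blast
    have "coherent (\<Union>(insert E0 (H ` D)))"
    proof (rule coherent_Union)
      fix E assume "E \<in> insert E0 (H ` D)" then show "coherent E"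
        using E0 growsD(2)[OF HD] by auto
    next
      fix E E' assume *: "E \<in> insert E0 (H ` D)" "E' \<in> insert E0 (H ` D)"
      show "E \<subseteq> E' \<or> E' \<subseteq> E"
      proof (cases "E = E0 \<or> E' = E0")
        case True then show ?thesis using E0H * by blast
      next
        case False
        then obtain j k where jk: "j \<in> D" "k \<in> D" "E = H j" "E' = H k" using * by blast
        then have "j = k \<or> j \<in> underS k \<or> k \<in> underS j"
          using D(1) TOTALS unfolding underS_def by blast
        then show ?thesis using le jk by blast
      qed
    qed
    then have cohP: "coherent (P D)" by (simp add: P_def)
    have fullP: "full X (P D)" if X: "X \<in> (\<Union>j \<in> D. \<X> j)" for X
    proof -
      obtain j where j: "j \<in> D" "X \<in> \<X> j" using X by blast
      show ?thesis
        using full_mono[OF growsD(3)[OF HD[OF j(1)] j(2)], of "P D"] j(1)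
        by (simp add: P_def UN_upper le_supI2)
    qed
    have newP: "\<exists>X \<in> (\<Union>j \<in> D. \<X> j). A \<subseteq> X" if new: "(A, f) \<in> P D" "(A, f) \<notin> E0" for A f
    proof -
      obtain j where j: "j \<in> D" "(A, f) \<in> H j" "(A, f) \<notin> E0" using new unfolding P_def by blast
      show ?thesis
      proof (cases "(A, f) \<in> P (underS j)")
        case True
        then obtain X where "X \<in> (\<Union>k \<in> underS j. \<X> k)" "A \<subseteq> X"
          using growsD(4)[OF IH[OF j(1)] _ j(3)] by auto
        then show ?thesis using D(2)[OF j(1)] by blast
      next
        case False
        then show ?thesis using growsD(4)[OF HD[OF j(1)] j(2)] j(1) by auto
      qed
    qed
    show ?thesis
      by (rule growsI[OF _ cohP fullP newP]) (simp_all add: P_def)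
  qed
  have step': "i \<in> Field r \<longrightarrow> grows E0 (\<Union>j \<in> underS i. \<X> j) (P (underS i))" for i
  proof (induction i rule: well_order_induct)
    case (1 i)
    show ?case
    proof
      assume "i \<in> Field r"
      show "grows E0 (\<Union>j \<in> underS i. \<X> j) (P (underS i))"
      proof (rule union)
        show "underS i \<subseteq> Field r" by (auto simp: underS_def Field_def)
        show "underS j \<subseteq> underS i" if "j \<in> underS i" for j
          using that TRANS ANTISYM unfolding underS_def trans_def antisym_def by blast
        show "grows E0 (\<Union>k \<in> underS j. \<X> k) (P (underS j))" if "j \<in> underS i" for j
          using 1 that unfolding underS_def by (auto simp: Field_def)
      qed
    qed
  qed
  have "grows E0 (\<Union>j \<in> Field r. \<X> j) (P (Field r))"
  proof (rule union)
    show "underS j \<subseteq> Field r" for j by (auto simp: underS_def Field_def)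
  qed (use step' in simp_all)
  then show ?thesis ..
qed

text \<open>There are two kinds of stages. Either \<open>\<X> i\<close> is extendable and countably
  many earlier stages dominate all earlier ones, which gives the countable bound on traces; or the
  countable sets in question are already covered by earlier stages, and nothing is added.\<close>

lemma extendable_chain:
  fixes r :: "'i rel"
  assumes wo: "Well_order r"
    and cnt: "\<And>i. i \<in> Field r \<Longrightarrow> countable (\<X> i)"
    and step: "\<And>i. i \<in> Field r \<Longrightarrow>
      extendable (\<X> i) \<and>
        (\<exists>K. countable K \<and> K \<subseteq> underS r i \<and>
          (\<forall>j \<in> underS r i. \<exists>k \<in> K. \<forall>X \<in> \<X> j. \<exists>X' \<in> \<X> k. X \<subseteq> X')) \<or>
      (\<forall>X \<in> \<X> i. \<forall>A. A \<subseteq> X \<and> countable A \<longrightarrow> (\<exists>j \<in> underS r i. \<exists>X' \<in> \<X> j. A \<subseteq> X'))"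
  shows "extendable (\<Union>i \<in> Field r. \<X> i)"
proof (rule extendableI)
  fix E0 :: "('a set \<times> ('a \<Rightarrow> nat)) set" and \<Y>
  assume E0: "coherent E0" and \<Y>: "countable \<Y>" "\<And>Y. Y \<in> \<Y> \<Longrightarrow> full Y E0"
    and trace: "\<And>X A f. X \<in> (\<Union>i \<in> Field r. \<X> i) \<Longrightarrow> (A, f) \<in> E0 \<Longrightarrow> \<exists>Y \<in> \<Y>. A \<inter> X \<subseteq> Y"
  show "\<exists>E'. grows E0 (\<Union>i \<in> Field r. \<X> i) E'"
  proof (rule grows_chain[OF wo E0])
    fix i E assume i: "i \<in> Field r" and E: "grows E0 (\<Union>j \<in> underS r i. \<X> j) E"
    from step[OF i] show "\<exists>E'. grows E (\<X> i) E'"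
    proof (elim disjE conjE exE)
      fix K assume ext: "extendable (\<X> i)" and K: "countable K" "K \<subseteq> underS r i"
        and cof: "\<forall>j \<in> underS r i. \<exists>k \<in> K. \<forall>X \<in> \<X> j. \<exists>X' \<in> \<X> k. X \<subseteq> X'"
      have KF: "K \<subseteq> Field r" using K(2) by (auto simp: underS_def Field_def)
      show ?thesis
      proof (rule extendableD[OF ext growsD(2)[OF E]])
        \<comment> \<open>\<open>\<Y>\<close> bounds the traces of the members of \<open>E0\<close>,
          and the sets with index in \<open>K\<close> bound those added since.\<close>
        show "countable (\<Y> \<union> (\<Union>k \<in> K. \<X> k))"
          using \<Y>(1) K(1) cnt KF by auto
      next
        fix Y assume "Y \<in> \<Y> \<union> (\<Union>k \<in> K. \<X> k)"
        then show "full Y E"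
          using full_mono[OF _ growsD(1)[OF E]] growsD(3)[OF E] K(2) \<Y>(2) by auto
      next
        fix X A f assume X: "X \<in> \<X> i" and A: "(A, f) \<in> E"
        show "\<exists>Y \<in> \<Y> \<union> (\<Union>k \<in> K. \<X> k). A \<inter> X \<subseteq> Y"
        proof (cases "(A, f) \<in> E0")
          case True
          have "X \<in> (\<Union>i \<in> Field r. \<X> i)" using i X by blast
          then have "\<exists>Y \<in> \<Y>. A \<inter> X \<subseteq> Y" by (rule trace[OF _ True])
          then show ?thesis by (meson UnI1)
        next
          case False
          then obtain j X' where "j \<in> underS r i" "X' \<in> \<X> j" "A \<subseteq> X'"
            using growsD(4)[OF E A False] by auto
          moreover from this obtain k X'' where "k \<in> K" "X'' \<in> \<X> k" "X' \<subseteq> X''"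
            using cof by meson
          ultimately have "X'' \<in> \<Y> \<union> (\<Union>k \<in> K. \<X> k)" "A \<inter> X \<subseteq> X''" by auto
          then show ?thesis by blast
        qed
      qed
    next
      assume *: "\<forall>X \<in> \<X> i. \<forall>A. A \<subseteq> X \<and> countable A \<longrightarrow> (\<exists>j \<in> underS r i. \<exists>X' \<in> \<X> j. A \<subseteq> X')"
      have fullX: "full X E" if "X \<in> \<X> i" for X
        unfolding full_def
      proof (intro allI impI, elim conjE)
        fix A assume "A \<subseteq> X" "countable A"
        moreover from this obtain j X' where "j \<in> underS r i" "X' \<in> \<X> j" "A \<subseteq> X'"
          using * \<open>X \<in> \<X> i\<close> by blast
        ultimately show "\<exists>f. (A, f) \<in> E" using growsD(3)[OF E, of X'] unfolding full_def by blast
      qed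
      \<comment> \<open>The family already serves this stage and is kept unchanged.\<close>
      have "grows E (\<X> i) E"
        by (rule growsI[OF order_refl growsD(2)[OF E] fullX]) simp_all
      then show ?thesis ..
    qed
  qed
qed

text \<open>Fullness concerns countable subsets only, so \<open>X\<close> may be replaced by subsets
  that cover these. Trace bounds for \<open>X\<close> are inherited by its subsets.\<close>

lemma extendable_cover:
  assumes ext: "extendable \<X>" and sub: "\<And>X'. X' \<in> \<X> \<Longrightarrow> X' \<subseteq> X"
    and cover: "\<And>A. A \<subseteq> X \<Longrightarrow> countable A \<Longrightarrow> \<exists>X' \<in> \<X>. A \<subseteq> X'"
  shows "extendable {X}"
proof (rule extendableI)
  fix E :: "('a set \<times> ('a \<Rightarrow> nat)) set" and \<Y>
  assume E: "coherent E" "countable \<Y>" "\<And>Y. Y \<in> \<Y> \<Longrightarrow> full Y E"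
    and trace: "\<And>X' A f. X' \<in> {X} \<Longrightarrow> (A, f) \<in> E \<Longrightarrow> \<exists>Y \<in> \<Y>. A \<inter> X' \<subseteq> Y"
  have "\<exists>Y \<in> \<Y>. A \<inter> X' \<subseteq> Y" if X': "X' \<in> \<X>" and A: "(A, f) \<in> E" for X' A f
  proof -
    have "\<exists>Y \<in> \<Y>. A \<inter> X \<subseteq> Y" by (rule trace[OF singletonI A])
    moreover have "A \<inter> X' \<subseteq> A \<inter> X" using sub[OF X'] by (rule Int_mono[OF order_refl])
    ultimately show ?thesis by (meson order_trans)
  qed
  then obtain E' where E': "grows E \<X> E'"
    using extendableD[OF ext E] by metis
  have fullX: "full X E'"
    unfolding full_def
  proof (intro allI impI, elim conjE)
    fix A assume A: "A \<subseteq> X" "countable A"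
    then obtain X' where "X' \<in> \<X>" "A \<subseteq> X'" using cover by blast
    then show "\<exists>f. (A, f) \<in> E'" using growsD(3)[OF E'] A unfolding full_def by blast
  qed
  have new: "\<exists>X \<in> {X}. A \<subseteq> X" if "(A, f) \<in> E'" "(A, f) \<notin> E" for A f
    using growsD(4)[OF E' that] sub by (meson order_trans singletonI)
  have "grows E {X} E'"
    by (rule growsI[OF growsD(1,2)[OF E'] _ new]) (use fullX in auto)
  then show "\<exists>E'. grows E {X} E'" ..
qed

text \<open>Along the natural numbers, the set of all predecessors of \<open>n\<close> is itself the
  required countable \<open>K\<close>.\<close>

lemma extendable_seq:
  fixes Z :: "nat \<Rightarrow> 'a set"
  assumes "\<And>n. extendable {Z n}"
  shows "extendable (range Z)"
proof -
  have "extendable (\<Union>n \<in> Field natLeq. {Z n})"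
  proof (rule extendable_chain[OF natLeq_Well_order])
    fix n :: nat
    have "\<exists>K. countable K \<and> K \<subseteq> underS natLeq n \<and>
          (\<forall>j \<in> underS natLeq n. \<exists>k \<in> K. \<forall>X \<in> {Z j}. \<exists>X' \<in> {Z k}. X \<subseteq> X')"
      by (rule exI[of _ "underS natLeq n"]) auto
    then show "extendable {Z n} \<and>
        (\<exists>K. countable K \<and> K \<subseteq> underS natLeq n \<and>
          (\<forall>j \<in> underS natLeq n. \<exists>k \<in> K. \<forall>X \<in> {Z j}. \<exists>X' \<in> {Z k}. X \<subseteq> X')) \<or>
      (\<forall>X \<in> {Z n}. \<forall>A. A \<subseteq> X \<and> countable A \<longrightarrow>
          (\<exists>j \<in> underS natLeq n. \<exists>X' \<in> {Z j}. A \<subseteq> X'))"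
      using assms by blast
  qed auto
  moreover have "(\<Union>n \<in> Field natLeq. {Z n}) = range Z"
    by (auto simp: Field_natLeq)
  ultimately show ?thesis by simp
qed

section \<open>Countable sets\<close>

text \<open>A point takes its value from the first \<open>B n\<close> that contains it, raised to at
  least that index. A bounded value can then come from finitely many of the sets only, which keeps
  the fibres finite; points outside all \<open>B n\<close> are numbered injectively.\<close>

lemma finite_to_one_amalgam:
  fixes B :: "nat \<Rightarrow> 'a set"
  assumes X: "countable X"
    and fin: "\<And>n k. finite {x \<in> B n. f n x = k}"
    and coh: "\<And>m n. finite {x \<in> B m \<inter> B n. f m x \<noteq> f n x}"
  shows "\<exists>h. (\<forall>k. finite {x \<in> X. h x = (k :: nat)}) \<and> (\<forall>n. finite {x \<in> B n. h x \<noteq> f n x})"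
proof -
  define l where "l x = (LEAST n. x \<in> B n)" for x
  define h where "h x = (if x \<in> (\<Union>n. B n) then max (f (l x) x) (l x) else to_nat_on X x)" for x
  have l: "x \<in> B (l x) \<and> l x \<le> n" if "x \<in> B n" for x n
    unfolding l_def using that by (auto intro: LeastI Least_le)
  have "finite {x \<in> X. h x = k}" for k
  proof (rule finite_subset)
    have "finite (to_nat_on X -` {k} \<inter> X)"
      by (rule finite_vimage_IntI[OF _ inj_on_to_nat_on[OF X]]) simp
    moreover have "{x \<in> X. to_nat_on X x = k} = to_nat_on X -` {k} \<inter> X" by auto
    ultimately show "finite ({x \<in> X. to_nat_on X x = k} \<union> (\<Union>n\<le>k. \<Union>j\<le>k. {x \<in> B n. f n x = j}))"
      using fin by auto
    show "{x \<in> X. h x = k} \<subseteq> {x \<in> X. to_nat_on X x = k} \<union> (\<Union>n\<le>k. \<Union>j\<le>k. {x \<in> B n. f n x = j})"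
    proof
      fix x assume x: "x \<in> {x \<in> X. h x = k}"
      show "x \<in> {x \<in> X. to_nat_on X x = k} \<union> (\<Union>n\<le>k. \<Union>j\<le>k. {x \<in> B n. f n x = j})"
      proof (cases "x \<in> (\<Union>n. B n)")
        case True
        then have "x \<in> B (l x)" "f (l x) x \<le> k" "l x \<le> k"
          using x l by (auto simp: h_def)
        then show ?thesis by blast
      qed (use x in \<open>auto simp: h_def\<close>)
    qed
  qed
  moreover have "finite {x \<in> B n. h x \<noteq> f n x}" for n
  proof (rule finite_subset)
    show "finite ((\<Union>m\<le>n. {x \<in> B m \<inter> B n. f m x \<noteq> f n x}) \<union> (\<Union>m\<le>n. \<Union>j\<le>n. {x \<in> B m. f m x = j}))"
      using fin coh by auto
    show "{x \<in> B n. h x \<noteq> f n x} \<subseteq>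
        (\<Union>m\<le>n. {x \<in> B m \<inter> B n. f m x \<noteq> f n x}) \<union> (\<Union>m\<le>n. \<Union>j\<le>n. {x \<in> B m. f m x = j})"
    proof
      fix x assume "x \<in> {x \<in> B n. h x \<noteq> f n x}"
      then have x: "x \<in> B n" "h x \<noteq> f n x" by auto
      then have lx: "x \<in> B (l x)" "l x \<le> n" "h x = max (f (l x) x) (l x)"
        using l by (auto simp: h_def)
      show "x \<in> (\<Union>m\<le>n. {x \<in> B m \<inter> B n. f m x \<noteq> f n x}) \<union> (\<Union>m\<le>n. \<Union>j\<le>n. {x \<in> B m. f m x = j})"
      proof (cases "f (l x) x = f n x")
        \<comment> \<open>Here \<open>h x\<close> differs from \<open>f n x\<close> only because the
          maximum is \<open>l x\<close>. Hence \<open>f (l x) x < l x \<le> n\<close>, which leaves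
          finitely many finite fibres.\<close>
        case True
        then have "f (l x) x \<le> n" using lx x by auto
        then show ?thesis using lx by blast
      next
        case False
        then show ?thesis using lx x by blast
      qed
    qed
  qed
  ultimately show ?thesis by (intro exI[of _ h]) simp
qed

text \<open>One finite-to-one function on \<open>X\<close>, amalgamated from functions on the traces
  of the members of \<open>\<Y>\<close>, serves all subsets of \<open>X\<close> at once.\<close>

lemma extendable_countable:
  assumes X: "countable X"
  shows "extendable {X}"
proof (rule extendableI)
  fix E :: "('a set \<times> ('a \<Rightarrow> nat)) set" and \<Y>
  assume E: "coherent E" and \<Y>: "countable \<Y>" "\<And>Y. Y \<in> \<Y> \<Longrightarrow> full Y E"
    and trace: "\<And>X' A f. X' \<in> {X} \<Longrightarrow> (A, f) \<in> E \<Longrightarrow> \<exists>Y \<in> \<Y>. A \<inter> X' \<subseteq> Y"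
  \<comment> \<open>\<open>from_nat_into\<close> is meaningful for nonempty \<open>\<Y>\<close>
    only, hence the default \<open>{}\<close>.\<close>
  define B where "B n = (if \<Y> = {} then {} else from_nat_into \<Y> n \<inter> X)" for n
  have "\<exists>f. (\<Y> \<noteq> {} \<longrightarrow> (B n, f) \<in> E)" for n
  proof (cases "\<Y> = {}")
    case False
    have "full (from_nat_into \<Y> n) E" by (rule \<Y>(2)[OF from_nat_into[OF False]])
    moreover have "B n \<subseteq> from_nat_into \<Y> n" "countable (B n)" using X by (auto simp: B_def)
    ultimately have "\<exists>f. (B n, f) \<in> E" unfolding full_def by simp
    then show ?thesis by simp
  qed simp
  then obtain f where f: "\<And>n. \<Y> \<noteq> {} \<Longrightarrow> (B n, f n) \<in> E" by metis
  have fin: "finite {x \<in> B n. f n x = k}" for n k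
  proof (cases "\<Y> = {}")
    case False show ?thesis by (rule coherentD(2)[OF E f[OF False]])
  qed (simp add: B_def)
  have coh: "finite {x \<in> B m \<inter> B n. f m x \<noteq> f n x}" for m n
  proof (cases "\<Y> = {}")
    case False show ?thesis by (rule coherentD(3)[OF E f[OF False] f[OF False]])
  qed (simp add: B_def)
  obtain h where "(\<forall>k. finite {x \<in> X. h x = (k :: nat)}) \<and> (\<forall>n. finite {x \<in> B n. h x \<noteq> f n x})"
    using finite_to_one_amalgam[of X B f, OF X fin coh] by (rule exE)
  then have h: "\<And>k. finite {x \<in> X. h x = (k :: nat)}"
    and hf: "\<And>n. finite {x \<in> B n. h x \<noteq> f n x}" by simp_all
  \<comment> \<open>The trace of \<open>A\<close> on \<open>X\<close> lies in some
    \<open>B n\<close>, so \<open>g\<close> and \<open>h\<close> can both be compared with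
    \<open>f n\<close> there.\<close>
  have old: "finite {x \<in> A \<inter> X. g x \<noteq> h x}" if A: "(A, g) \<in> E" for A g
  proof -
    obtain Y where Y: "Y \<in> \<Y>" "A \<inter> X \<subseteq> Y" using trace[OF singletonI A] by (elim bexE)
    obtain n where n: "from_nat_into \<Y> n = Y"
      using from_nat_into_surj[OF \<Y>(1) Y(1)] by (elim exE)
    have "A \<inter> X \<subseteq> B n" using Y n by (auto simp: B_def)
    then have "{x \<in> A \<inter> X. g x \<noteq> h x} \<subseteq> {x \<in> A \<inter> B n. g x \<noteq> f n x} \<union> {x \<in> B n. h x \<noteq> f n x}"
      by auto
    moreover have "finite {x \<in> A \<inter> B n. g x \<noteq> f n x}"
      by (rule coherentD(3)[OF E A f]) (use Y(1) in auto)
    ultimately show ?thesis by (rule finite_subset[OF _ finite_UnI[OF _ hf]])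
  qed
  define E' where "E' = E \<union> {(A, h) | A. A \<subseteq> X}"
  have "coherent E'"
  proof (rule coherentI)
    fix A f k assume "(A, f) \<in> E'"
    then consider "(A, f) \<in> E" | "A \<subseteq> X" "f = h" by (auto simp: E'_def)
    then have "countable A \<and> finite {x \<in> A. f x = k}"
    proof cases
      case 1 then show ?thesis using coherentD(1,2)[OF E] by auto
    next
      case 2
      have "finite {x \<in> A. f x = k}"
        by (rule finite_subset[OF _ h[of k]]) (use 2 in auto)
      then show ?thesis using countable_subset[OF 2(1) X] by simp
    qed
    then show "countable A" "finite {x \<in> A. f x = k}" by simp_all
  next
    fix A f B g assume AB: "(A, f) \<in> E'" "(B, g) \<in> E'"
    consider "(A, f) \<in> E" "(B, g) \<in> E" | "(A, f) \<in> E" "B \<subseteq> X" "g = h"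
      | "(B, g) \<in> E" "A \<subseteq> X" "f = h" | "f = h" "g = h"
      using AB by (auto simp: E'_def)
    then show "finite {x \<in> A \<inter> B. f x \<noteq> g x}"
    proof cases
      case 1 then show ?thesis using coherentD(3)[OF E] by blast
    next
      case 2 show ?thesis by (rule finite_subset[OF _ old[OF 2(1)]]) (use 2 in auto)
    next
      case 3 show ?thesis by (rule finite_subset[OF _ old[OF 3(1)]]) (use 3 in auto)
    qed auto
  qed
  then have "grows E {X} E'"
    by (rule growsI[rotated]) (auto simp: E'_def full_def)
  then show "\<exists>E'. grows E {X} E'" ..
qed

section \<open>Cofinality\<close>

text \<open>The bound is not strict, so the empty set and sets with a largest element qualify. A
  single case distinction then treats zero, successors and limits of countable cofinality
  alike.\<close>

definition ccof :: "'a rel \<Rightarrow> 'a set \<Rightarrow> bool" where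
  "ccof r S \<longleftrightarrow> (\<exists>K. countable K \<and> K \<subseteq> S \<and> (\<forall>a \<in> S. \<exists>k \<in> K. (a, k) \<in> r))"

lemma underS_trans:
  assumes "Well_order r"
  shows "a \<in> underS r b \<Longrightarrow> b \<in> underS r c \<Longrightarrow> a \<in> underS r c"
    and "(a, b) \<in> r \<Longrightarrow> b \<in> underS r c \<Longrightarrow> a \<in> underS r c"
    and "a \<in> underS r b \<Longrightarrow> (b, c) \<in> r \<Longrightarrow> a \<in> underS r c"
proof -
  interpret wo_rel r using assms by (simp add: wo_rel_def)
  show "a \<in> underS b \<Longrightarrow> b \<in> underS c \<Longrightarrow> a \<in> underS c"
    and "(a, b) \<in> r \<Longrightarrow> b \<in> underS c \<Longrightarrow> a \<in> underS c"
    and "a \<in> underS b \<Longrightarrow> (b, c) \<in> r \<Longrightarrow> a \<in> underS c"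
    using TRANS ANTISYM unfolding underS_def trans_def antisym_def by blast+
qed

lemma not_in_underS_iff:
  assumes "Well_order r" "a \<in> Field r" "b \<in> Field r"
  shows "a \<notin> underS r b \<longleftrightarrow> (b, a) \<in> r"
proof -
  interpret wo_rel r using assms by (simp add: wo_rel_def)
  show ?thesis
    using assms(2,3) TOTALS ANTISYM unfolding underS_def antisym_def by blast
qed

lemma underS_subset_Field: "underS r a \<subseteq> Field r"
  by (auto simp: underS_def Field_def)

lemma not_ccofD:
  assumes wo: "Well_order r" and S: "S \<subseteq> Field r" and "\<not> ccof r S" and K: "countable K" "K \<subseteq> S"
  shows "\<exists>b \<in> S. K \<subseteq> underS r b"
proof -
  obtain b where b: "b \<in> S" "\<forall>k \<in> K. (b, k) \<notin> r"
    using assms(3) K unfolding ccof_def by auto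
  have "k \<in> underS r b" if "k \<in> K" for k
    using not_in_underS_iff[OF wo, of k b] b S K(2) that by auto
  then show ?thesis using b(1) by (intro bexI[of _ b] subsetI)
qed

text \<open>Recursion over the proper initial segments of \<open>|X|\<close>, which have smaller
  cardinality. In a segment of uncountable cofinality countable subsets are bounded, so its stage
  adds nothing; the same argument for \<open>X\<close> itself shows that the segments cover its
  countable subsets.\<close>

lemma extendable_not_ccof:
  fixes X :: "'a set"
  assumes IH: "\<And>Y :: 'a set. |Y| <o |X| \<Longrightarrow> extendable {Y}" and ncc: "\<not> ccof |X| X"
  shows "extendable {X}"
proof -
  have wo: "Well_order |X|" and F: "Field |X| = X"
    by (rule card_of_Well_order) (rule Field_card_of)
  let ?u = "underS |X|"
  have sub: "?u i \<subseteq> X" for i using underS_subset_Field[of "|X|"] F by simp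
  have "extendable (\<Union>i \<in> Field |X|. {?u i})"
  proof (rule extendable_chain[OF wo])
    fix i assume i: "i \<in> Field |X|"
    show "extendable {?u i} \<and>
        (\<exists>K. countable K \<and> K \<subseteq> ?u i \<and> (\<forall>j \<in> ?u i. \<exists>k \<in> K. \<forall>X \<in> {?u j}. \<exists>X' \<in> {?u k}. X \<subseteq> X')) \<or>
      (\<forall>X \<in> {?u i}. \<forall>A. A \<subseteq> X \<and> countable A \<longrightarrow> (\<exists>j \<in> ?u i. \<exists>X' \<in> {?u j}. A \<subseteq> X'))"
    proof (cases "ccof |X| (?u i)")
      case True
      then obtain K where K: "countable K" "K \<subseteq> ?u i" "\<forall>a \<in> ?u i. \<exists>k \<in> K. (a, k) \<in> |X|"
        unfolding ccof_def by (elim exE conjE)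
      have "\<forall>j \<in> ?u i. \<exists>k \<in> K. ?u j \<subseteq> ?u k"
      proof
        fix j assume "j \<in> ?u i"
        then obtain k where "k \<in> K" "(j, k) \<in> |X|" using K(3) by (meson)
        then show "\<exists>k \<in> K. ?u j \<subseteq> ?u k"
          using underS_trans(3)[OF wo] by (intro bexI[of _ k] subsetI)
      qed
      moreover have "extendable {?u i}"
        by (rule IH) (rule card_of_underS[OF card_of_Card_order i])
      ultimately show ?thesis using K(1,2) by (intro disjI1 conjI exI[of _ K]) simp_all
    next
      case False
      have "\<exists>j \<in> ?u i. A \<subseteq> ?u j" if "A \<subseteq> ?u i" "countable A" for A
        by (rule not_ccofD[OF wo underS_subset_Field False that(2,1)])
      then show ?thesis by (intro disjI2) simp
    qed
  qed simp
  then have "extendable (?u ` X)" by (simp add: F UNION_singleton_eq_range)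
  then show ?thesis
  proof (rule extendable_cover)
    show "X' \<subseteq> X" if "X' \<in> ?u ` X" for X' using that sub by auto
    fix A assume "A \<subseteq> X" "countable A"
    then have "\<exists>b \<in> X. A \<subseteq> ?u b"
      by (intro not_ccofD[OF wo _ ncc]) (simp_all add: F)
    then show "\<exists>X' \<in> ?u ` X. A \<subseteq> X'" by auto
  qed
qed

lemma countable_ordLess_uncountable:
  assumes "countable V" "uncountable X"
  shows "|V| <o |X|"
proof (rule ccontr)
  assume "\<not> |V| <o |X|"
  then have "|X| \<le>o |V|" by (simp add: card_of_Well_order not_ordLess_iff_ordLeq)
  then obtain f where "inj_on f X" "f ` X \<subseteq> V" using card_of_ordLeq by metis
  then show False
    using assms countable_image_inj_on[of f X] countable_subset by metis
qed

section \<open>Filtrations by smaller sets\<close>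

text \<open>Finite unions of initial segments ending at the points of a countable cofinal set are
  smaller than the cardinal \<open>|X|\<close>, and together they exhaust \<open>X\<close>.\<close>

lemma ccof_filtration:
  assumes unc: "uncountable X" and cc: "ccof |X| X"
  obtains T :: "nat \<Rightarrow> 'a set" where "X = (\<Union>n. T n)" "mono T" "\<And>n. infinite (T n)"
    and "\<And>n. |T n| <o |X|"
proof -
  have F: "Field |X| = X" by (rule Field_card_of)
  have inf: "infinite X" using unc countable_finite by auto
  obtain K where K: "countable K" "K \<subseteq> X" "\<forall>a \<in> X. \<exists>k \<in> K. (a, k) \<in> |X|"
    using cc unfolding ccof_def by (elim exE conjE)
  have Kne: "K \<noteq> {}" using K(3) inf by auto
  \<comment> \<open>Adding \<open>N\<close> makes every level infinite, as the later cardinal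
    estimates require.\<close>
  obtain N where N: "N \<subseteq> X" "infinite N" "countable N"
    using infinite_countable_subset'[OF inf] by (elim exE conjE)
  \<comment> \<open>The endpoint is included because cofinality in \<open>ccof\<close> is not
    strict.\<close>
  define U where "U n = insert (from_nat_into K n) (underS |X| (from_nat_into K n))" for n
  define T where "T n = N \<union> (\<Union>m\<le>n. U m)" for n
  have kn: "from_nat_into K n \<in> X" for n using from_nat_into[OF Kne] K(2) by auto
  have USub: "U n \<subseteq> X" for n
    using kn underS_subset_Field[of "|X|"] F unfolding U_def by auto
  have Uless: "|U n| <o |X|" for n
  proof -
    have "|{from_nat_into K n} \<union> underS |X| (from_nat_into K n)| <o |X|"
    proof (rule card_of_Un_ordLess_infinite[OF inf])
      show "|{from_nat_into K n}| <o |X|"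
        by (rule countable_ordLess_uncountable[OF _ unc]) simp
      show "|underS |X| (from_nat_into K n)| <o |X|"
        by (rule card_of_underS[OF card_of_Card_order]) (simp add: F kn)
    qed
    then show ?thesis by (simp add: U_def)
  qed
  have "|\<Union>m\<le>n. U m| <o |X|" for n
  proof (induction n)
    case 0 then show ?case using Uless by simp
  next
    case (Suc n)
    have "|U (Suc n) \<union> (\<Union>m\<le>n. U m)| <o |X|"
      by (rule card_of_Un_ordLess_infinite[OF inf Uless Suc])
    then show ?case by (simp add: atMost_Suc)
  qed
  then have Tless: "|T n| <o |X|" for n
    unfolding T_def
    by (intro card_of_Un_ordLess_infinite[OF inf] countable_ordLess_uncountable[OF N(3) unc])
  show thesis
  proof
    show "X = (\<Union>n. T n)"
    proof
      show "(\<Union>n. T n) \<subseteq> X" using USub N(1) by (auto simp: T_def)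
      show "X \<subseteq> (\<Union>n. T n)"
      proof
        fix a assume a: "a \<in> X"
        then obtain k where k: "k \<in> K" "(a, k) \<in> |X|" using K(3) by meson
        obtain n where n: "from_nat_into K n = k"
          using from_nat_into_surj[OF K(1) k(1)] by (elim exE)
        have "a \<in> U n" using k n by (auto simp: U_def underS_def)
        then show "a \<in> (\<Union>n. T n)" by (auto simp: T_def)
      qed
    qed
    show "mono T" unfolding T_def by (intro monoI Un_mono UN_mono) auto
    show "infinite (T n)" for n using N(2) by (simp add: T_def)
  qed (rule Tless)
qed

text \<open>Otherwise every level is smaller than \<open>V\<close>. Then \<open>V\<close> is
  infinite and bounds the countable union of the levels, which is \<open>X\<close>.\<close>

lemma ordLeq_filtration:
  fixes T :: "nat \<Rightarrow> 'a set" and V :: "'b set"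
  assumes T: "X = (\<Union>n. T n)" "infinite (T 0)" and V: "|V| <o |X|"
  shows "\<exists>n. |V| \<le>o |T n|"
proof (rule ccontr)
  assume *: "\<nexists>n. |V| \<le>o |T n|"
  then have less: "|T n| <o |V|" for n
    by (simp add: card_of_Well_order not_ordLeq_iff_ordLess)
  have inf: "infinite V"
    using card_of_ordLeq_infinite[OF ordLess_imp_ordLeq[OF less[of 0]] T(2)] .
  have "|\<Union>n \<in> UNIV. T n| \<le>o |V|"
    by (rule card_of_UNION_ordLeq_infinite[OF inf])
      (use inf less ordLess_imp_ordLeq in \<open>auto simp: infinite_iff_card_of_nat\<close>)
  then show False using V T(1) not_ordLess_ordLeq by blast
qed

section \<open>Comparison with \<open>cf\<close>\<close>

text \<open>The choice in \<open>cf\<close> is meaningful once some cofinal set exists: a cofinal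
  set of least cardinality is then available by well-foundedness of cardinals.\<close>

lemma cf_ordLeq:
  assumes "Y \<subseteq> Field r" "cofinal Y r"
  shows "cf r \<le>o |Y|" and "\<exists>X. X \<subseteq> Field r \<and> cofinal X r \<and> cf r = |X|"
proof -
  let ?P = "\<lambda>X. X \<subseteq> Field r \<and> cofinal X r \<and> (\<forall>Y. Y \<subseteq> Field r \<and> cofinal Y r \<longrightarrow> |X| \<le>o |Y| )"
  let ?R = "{|X| | X. X \<subseteq> Field r \<and> cofinal X r}"
  have "\<exists>q \<in> ?R. \<forall>q' \<in> ?R. q \<le>o q'"
    by (rule exists_minim_Card_order) (use assms card_of_Card_order in auto)
  then have "\<exists>X. ?P X" by auto
  then have "?P (SOME X. ?P X)" by (rule someI_ex)
  then show "cf r \<le>o |Y|" and "\<exists>X. X \<subseteq> Field r \<and> cofinal X r \<and> cf r = |X|"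
    using assms unfolding cf_def by auto
qed

text \<open>An infinite cardinal has no largest element. Hence a set cofinal in the weak sense is
  cofinal in the strict sense of \<open>cf\<close>, and finite sets are never cofinal.\<close>

lemma cf_of_ccof:
  assumes "infinite X" and cc: "ccof |X| X"
  shows "cf |X| =o natLeq"
proof -
  have wo: "Well_order |X|" and F: "Field |X| = X"
    by (rule card_of_Well_order) (rule Field_card_of)
  have lim: "\<exists>b \<in> X. a \<noteq> b \<and> (a, b) \<in> |X|" if "a \<in> X" for a
    using infinite_Card_order_limit[OF card_of_Card_order, of X a] assms(1) that F by auto
  obtain K where K: "countable K" "K \<subseteq> X" "\<forall>a \<in> X. \<exists>k \<in> K. (a, k) \<in> |X|"
    using cc unfolding ccof_def by (elim exE conjE)
  have "cofinal K |X|"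
    unfolding cofinal_def F
  proof
    fix a assume "a \<in> X"
    then obtain b where b: "b \<in> X" "a \<in> underS |X| b" using lim by (auto simp: underS_def)
    then obtain k where "k \<in> K" "(b, k) \<in> |X|" using K(3) by meson
    moreover from this have "a \<in> underS |X| k" using underS_trans(3)[OF wo] b(2) by simp
    ultimately show "\<exists>b \<in> K. a \<noteq> b \<and> (a, b) \<in> |X|" by (auto simp: underS_def)
  qed
  then have cfK: "cf |X| \<le>o |K|" "\<exists>Y. Y \<subseteq> Field |X| \<and> cofinal Y |X| \<and> cf |X| = |Y|"
    using cf_ordLeq[of K "|X|"] K(2) F by simp_all
  then obtain Y where Y: "Y \<subseteq> X" "cofinal Y |X|" "cf |X| = |Y|" using F by auto
  have ub: "\<exists>b \<in> X. V \<subseteq> underS |X| b" if "finite V" "V \<subseteq> X" for V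
    using that
  proof (induction V)
    case empty then show ?case using assms(1) by (metis finite.emptyI ex_in_conv empty_subsetI)
  next
    case (insert a V)
    then obtain b where b: "b \<in> X" "V \<subseteq> underS |X| b" by auto
    obtain c where c: "c \<in> X" "a \<in> underS |X| c" using lim[of a] insert.prems by (auto simp: underS_def)
    show ?case
    proof (cases "(b, c) \<in> |X|")
      case True
      then have "V \<subseteq> underS |X| c" using underS_trans(3)[OF wo _ True] b(2) by auto
      then show ?thesis using c by auto
    next
      case False
      then have "c \<in> underS |X| b" using not_in_underS_iff[OF wo, of c b] b(1) c(1) F by auto
      then show ?thesis using underS_trans(1)[OF wo c(2)] b by auto
    qed
  qed
  have "infinite Y"
  proof
    assume "finite Y"
    then obtain b where b: "b \<in> X" "Y \<subseteq> underS |X| b" using ub Y(1) by meson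
    then obtain y where "y \<in> Y" "b \<in> underS |X| y" using Y(2) F by (auto simp: cofinal_def underS_def)
    then have "y \<in> underS |X| y" using underS_trans(1)[OF wo] b(2) by auto
    then show False by (simp add: underS_def)
  qed
  then have "natLeq \<le>o cf |X|" using Y(3) infinite_iff_natLeq_ordLeq by metis
  moreover have "cf |X| \<le>o natLeq"
  proof -
    obtain f :: "'a \<Rightarrow> nat" where "inj_on f K" using K(1) by (rule countableE)
    then have "|K| \<le>o |UNIV :: nat set|" by (rule card_of_ordLeqI) simp
    then show ?thesis using cfK(1) card_of_nat ordLeq_ordIso_trans ordLeq_transitive by metis
  qed
  ultimately show ?thesis by (simp add: ordIso_iff_ordLeq)
qed

text \<open>This is the condition under which \<open>square\<close> makes \<open>C \<alpha>\<close>
  small. An injection into \<open>X\<close> splits the points below \<open>\<alpha>\<close> into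
  countably many pieces of size less than \<open>|X|\<close>: either some piece is cofinal, or
  bounds for the single pieces form a countable cofinal set.\<close>

lemma cf_limit_ordLess:
  assumes unc: "uncountable X" and cc: "ccof |X| X" and \<alpha>: "\<alpha> \<in> Lim (cardSuc |X| ) (Field (cardSuc |X| ))"
  shows "cf (Restr (cardSuc |X| ) (underS (cardSuc |X| ) \<alpha>)) <o |X|"
proof -
  let ?R = "cardSuc |X|" let ?U = "underS ?R \<alpha>" let ?r = "Restr ?R ?U"
  have CR: "Card_order ?R" by (rule cardSuc_Card_order[OF card_of_Card_order])
  then have wo: "Well_order ?R" by (simp add: card_order_on_def)
  then have refl: "Refl ?R"
    by (simp add: well_order_on_def linear_order_on_def partial_order_on_def preorder_on_def)
  have F: "Field ?r = ?U" by (rule Refl_Field_Restr2[OF refl underS_subset_Field])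
  have \<alpha>F: "\<alpha> \<in> Field ?R" using \<alpha> by (simp add: Defs.Lim_def)
  have unb: "\<exists>c \<in> ?U. b \<in> underS ?R c" if "b \<in> ?U" for b
    using \<alpha> that unfolding Defs.Lim_def unbounded_below_def by auto
  obtain T :: "nat \<Rightarrow> 'a set" where T: "X = (\<Union>n. T n)" "mono T" "\<And>n. infinite (T n)" "\<And>n. |T n| <o |X|"
    using ccof_filtration[OF unc cc] by metis
  have "|?U| <o ?R" by (rule card_of_underS[OF CR \<alpha>F])
  then have "|?U| \<le>o |X|"
    using cardSuc_ordLess_ordLeq cardSuc_ordLeq_ordLess[OF card_of_Card_order[of X] card_of_Card_order[of ?U]]
    by simp
  then obtain f where f: "inj_on f ?U" "f ` ?U \<subseteq> X" using card_of_ordLeq by metis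
  define W where "W n = {a \<in> ?U. f a \<in> T n}" for n
  have Wcard: "|W n| <o |X|" for n
  proof (rule ordLeq_ordLess_trans[OF _ T(4)])
    show "|W n| \<le>o |T n|"
      by (rule card_of_ordLeqI[of f]) (use f(1) in \<open>auto simp: W_def inj_on_def\<close>)
  qed
  have WU: "\<exists>n. a \<in> W n" if "a \<in> ?U" for a using that f(2) T(1) by (auto simp: W_def)
  have cofI: "cofinal Y ?r" if Y: "Y \<subseteq> ?U" and *: "\<And>a. a \<in> ?U \<Longrightarrow> \<exists>y \<in> Y. a \<in> underS ?R y" for Y
    unfolding cofinal_def F
  proof
    fix a assume a: "a \<in> ?U"
    then obtain y where "y \<in> Y" "a \<in> underS ?R y" using * by meson
    then show "\<exists>b \<in> Y. a \<noteq> b \<and> (a, b) \<in> ?r" using Y a by (intro bexI[of _ y]) (auto simp: underS_def)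
  qed
  have "\<exists>Y. Y \<subseteq> ?U \<and> cofinal Y ?r \<and> |Y| <o |X|"
  proof (cases "\<exists>n. cofinal (W n) ?r")
    case True
    then obtain n where "cofinal (W n) ?r" ..
    moreover have "W n \<subseteq> ?U" by (auto simp: W_def)
    ultimately show ?thesis using Wcard by (intro exI[of _ "W n"] conjI)
  next
    case False
    \<comment> \<open>A piece that is not cofinal has a point \<open>b n\<close> that no member of
      the piece exceeds.\<close>
    have "\<exists>b \<in> ?U. \<forall>c \<in> W n. b \<notin> underS ?R c" for n
    proof (rule ccontr)
      assume "\<not> ?thesis"
      then have "cofinal (W n) ?r" by (intro cofI) (auto simp: W_def)
      then show False using False by simp
    qed
    then obtain b where b: "\<And>n. b n \<in> ?U" "\<And>n c. c \<in> W n \<Longrightarrow> b n \<notin> underS ?R c" by metis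
    have "cofinal (range b) ?r"
    proof (rule cofI)
      fix a assume "a \<in> ?U"
      then obtain c where c: "c \<in> ?U" "a \<in> underS ?R c" using unb by meson
      \<comment> \<open>Since \<open>\<alpha>\<close> is a limit, \<open>c\<close> lies strictly
        above \<open>a\<close>; the bound of the piece containing \<open>c\<close> is then strictly
        above \<open>a\<close> too.\<close>
      obtain n where n: "c \<in> W n" using WU[OF c(1)] ..
      have "(c, b n) \<in> ?R"
        using not_in_underS_iff[OF wo, of "b n" c] b(1)[of n] b(2)[OF n] c(1) underS_subset_Field[of ?R \<alpha>]
        by auto
      then have "a \<in> underS ?R (b n)" by (rule underS_trans(3)[OF wo c(2)])
      then show "\<exists>y \<in> range b. a \<in> underS ?R y" by auto
    qed (use b(1) in auto)
    moreover have "|range b| <o |X|" by (rule countable_ordLess_uncountable[OF _ unc]) simp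
    ultimately show ?thesis using b(1) by (intro exI[of _ "range b"]) auto
  qed
  then obtain Y where Y: "Y \<subseteq> ?U" "cofinal Y ?r" "|Y| <o |X|" by (elim exE conjE)
  then show ?thesis using cf_ordLeq(1)[of Y ?r] F ordLeq_ordLess_trans by metis
qed

section \<open>The singular step\<close>

text \<open>The square sequence is extended to all indices, and its smallness clause is freed of
  \<open>cf\<close>. The fourth property is the use made of coherence: below \<open>\<alpha>\<close>
  of uncountable cofinality, \<open>C \<alpha>\<close> has a limit point above any countable
  set.\<close>

lemma square_ladder:
  fixes X :: "'a set"
  defines "R \<equiv> cardSuc |X|"
  assumes unc: "uncountable X" and cc: "ccof |X| X" and sq: "square |X|"
  obtains C :: "'a set \<Rightarrow> 'a set set" where
    "\<And>\<alpha>. \<alpha> \<in> Field R \<Longrightarrow> C \<alpha> \<subseteq> underS R \<alpha>"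
    "\<And>\<alpha> \<beta>. \<alpha> \<in> Field R \<Longrightarrow> \<beta> \<in> underS R \<alpha> \<Longrightarrow> \<exists>\<gamma> \<in> C \<alpha>. (\<beta>, \<gamma>) \<in> R"
    "\<And>\<alpha>. \<alpha> \<in> Field R \<Longrightarrow> |C \<alpha>| <o |X|"
    "\<And>\<alpha> K. \<alpha> \<in> Field R \<Longrightarrow> \<not> ccof R (underS R \<alpha>) \<Longrightarrow> countable K \<Longrightarrow> K \<subseteq> underS R \<alpha> \<Longrightarrow>
      \<exists>\<gamma> \<in> underS R \<alpha>. K \<subseteq> underS R \<gamma> \<and> C \<gamma> = C \<alpha> \<inter> underS R \<gamma>"
    "\<And>\<beta>. \<beta> \<in> Field R \<Longrightarrow> \<exists>\<alpha> \<in> Field R. \<beta> \<in> C \<alpha>"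
proof -
  have CR: "Card_order R" unfolding R_def by (rule cardSuc_Card_order[OF card_of_Card_order])
  then have wo: "Well_order R" by (simp add: card_order_on_def)
  then interpret wo_rel R by (simp add: wo_rel_def)
  have "infinite X" using unc countable_finite by auto
  then have infR: "infinite (Field R)"
    unfolding R_def by (simp add: card_of_cardSuc_finite)
  let ?L = "Defs.Lim R (Field R)"
  obtain D where D: "\<forall>\<alpha> \<in> ?L. club_in R \<alpha> (D \<alpha>) \<and>
      (\<forall>\<beta> \<in> Defs.Lim R (D \<alpha>) \<inter> underS \<alpha>. D \<beta> = D \<alpha> \<inter> underS \<beta>) \<and>
      (cf (Restr R (underS \<alpha>)) <o |X| \<longrightarrow> |D \<alpha>| <o |X| )"
    using sq unfolding square_def Let_def R_def[symmetric] by (elim exE)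
  have club: "D \<alpha> \<subseteq> underS \<alpha>" "unbounded_below R \<alpha> (D \<alpha>)" if "\<alpha> \<in> ?L" for \<alpha>
    using bspec[OF D that] unfolding club_in_def by simp_all
  have coh: "D \<beta> = D \<alpha> \<inter> underS \<beta>" if "\<alpha> \<in> ?L" "\<beta> \<in> Defs.Lim R (D \<alpha>)" "\<beta> \<in> underS \<alpha>" for \<alpha> \<beta>
    using bspec[OF D that(1)] that(2,3) by simp
  have small: "|D \<alpha>| <o |X|" if "\<alpha> \<in> ?L" for \<alpha>
    using bspec[OF D that] cf_limit_ordLess[OF unc cc that[unfolded R_def], folded R_def] by simp
  \<comment> \<open>Off the limits this is the set of largest elements below
    \<open>\<alpha>\<close>: the predecessor at a successor, and empty at the least element.\<close>
  define C where "C \<alpha> = (if \<alpha> \<in> ?L then D \<alpha> else {b \<in> underS \<alpha>. \<forall>c \<in> underS \<alpha>. b \<notin> underS c})" for \<alpha>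
  have FS: "underS \<alpha> \<subseteq> Field R" for \<alpha> by (rule underS_subset_Field)
  have C1: "C \<alpha> \<subseteq> underS \<alpha>" for \<alpha> using club(1) by (auto simp: C_def)
  have C2: "\<exists>\<gamma> \<in> C \<alpha>. (\<beta>, \<gamma>) \<in> R" if \<alpha>: "\<alpha> \<in> Field R" and \<beta>: "\<beta> \<in> underS \<alpha>" for \<alpha> \<beta>
  proof (cases "\<alpha> \<in> ?L")
    case True
    then obtain c where "c \<in> D \<alpha>" "\<beta> \<in> underS c"
      using club(2)[OF True] \<beta> unfolding unbounded_below_def by auto
    then show ?thesis using True by (auto simp: C_def underS_def)
  next
    case False
    then have "\<not> unbounded_below R \<alpha> (Field R)" using \<alpha> \<beta> by (auto simp: Defs.Lim_def)
    then obtain b where b: "b \<in> underS \<alpha>" "\<forall>c \<in> underS \<alpha>. b \<notin> underS c"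
      unfolding unbounded_below_def using FS by auto
    then have "b \<in> C \<alpha>" using False by (simp add: C_def)
    moreover have "(\<beta>, b) \<in> R"
      using not_in_underS_iff[OF wo, of b \<beta>] b \<beta> FS by auto
    ultimately show ?thesis by (intro bexI)
  qed
  have Cnl: "countable (C \<alpha>)" if "\<alpha> \<notin> ?L" for \<alpha>
  proof -
    have "b = b'" if "b \<in> C \<alpha>" "b' \<in> C \<alpha>" for b b'
    proof -
      have "b \<in> Field R" "b' \<in> Field R" using that C1 FS by auto
      moreover have "b \<notin> underS b'" "b' \<notin> underS b"
        using that \<open>\<alpha> \<notin> ?L\<close> by (auto simp: C_def)
      ultimately have "(b', b) \<in> R" "(b, b') \<in> R"
        using not_in_underS_iff[OF wo] by simp_all
      then show ?thesis using ANTISYM unfolding antisym_def by simp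
    qed
    moreover have "(SOME b. b \<in> C \<alpha>) \<in> C \<alpha>" if "b \<in> C \<alpha>" for b
      using that by (rule someI)
    ultimately have "C \<alpha> \<subseteq> {SOME b. b \<in> C \<alpha>}" by (intro subsetI singletonI) simp
    then show ?thesis by (rule countable_subset) simp
  qed
  have C3: "|C \<alpha>| <o |X|" for \<alpha>
  proof (cases "\<alpha> \<in> ?L")
    case True then show ?thesis using small by (simp add: C_def)
  next
    case False then show ?thesis by (rule countable_ordLess_uncountable[OF Cnl unc])
  qed
  have C4: "\<exists>\<gamma> \<in> underS \<alpha>. K \<subseteq> underS \<gamma> \<and> C \<gamma> = C \<alpha> \<inter> underS \<gamma>"
    if \<alpha>: "\<alpha> \<in> Field R" and ncc: "\<not> ccof R (underS \<alpha>)" and K: "countable K" "K \<subseteq> underS \<alpha>" for \<alpha> K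
  proof -
    \<comment> \<open>At any other index \<open>C \<alpha>\<close> would be a countable cofinal
      set.\<close>
    have L: "\<alpha> \<in> ?L"
    proof (rule ccontr)
      assume "\<alpha> \<notin> ?L"
      then have "ccof R (underS \<alpha>)"
        unfolding ccof_def using Cnl C1 C2[OF \<alpha>] by (intro exI[of _ "C \<alpha>"] conjI ballI)
      then show False using ncc by simp
    qed
    obtain \<eta> where \<eta>: "\<eta> \<in> underS \<alpha>" "K \<subseteq> underS \<eta>"
      using not_ccofD[OF wo FS ncc K] by (elim bexE)
    have "\<exists>c. c \<in> D \<alpha> \<inter> underS \<alpha> \<and> b \<in> underS c" if "b \<in> underS \<alpha>" for b
      using club(2)[OF L] that unfolding unbounded_below_def by auto
    then obtain nx where nx: "\<And>b. b \<in> underS \<alpha> \<Longrightarrow> nx b \<in> D \<alpha> \<inter> underS \<alpha> \<and> b \<in> underS (nx b)"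
      by metis
    \<comment> \<open>Starting from a bound \<open>\<eta>\<close> of \<open>K\<close>, the sequence
      climbs through points of \<open>D \<alpha>\<close>. Its supremum will be a limit point of
      \<open>D \<alpha>\<close>, and it stays below \<open>\<alpha>\<close> by uncountable
      cofinality.\<close>
    define s where "s n = (nx ^^ n) \<eta>" for n
    have s\<alpha>: "s n \<in> underS \<alpha>" for n
      by (induction n) (use \<eta>(1) nx in \<open>auto simp: s_def\<close>)
    have sS: "s (Suc n) \<in> D \<alpha>" "s n \<in> underS (s (Suc n))" for n
      using nx[OF s\<alpha>[of n]] by (simp_all add: s_def)
    have "\<exists>b \<in> underS \<alpha>. range s \<subseteq> underS b"
      by (rule not_ccofD[OF wo FS ncc]) (use s\<alpha> in auto)
    then obtain \<delta> where \<delta>: "\<delta> \<in> underS \<alpha>" "range s \<subseteq> underS \<delta>" by (elim bexE)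
    let ?B = "{\<delta> \<in> Field R. range s \<subseteq> underS \<delta>}"
    \<comment> \<open>The sequence increases strictly, so its least strict upper bound is its
      supremum.\<close>
    define \<gamma> where "\<gamma> = minim ?B"
    have \<delta>B: "\<delta> \<in> ?B" using \<delta> FS by auto
    then have "\<gamma> \<in> ?B" unfolding \<gamma>_def by (intro minim_in) auto
    then have \<gamma>: "\<gamma> \<in> Field R" "range s \<subseteq> underS \<gamma>" by auto
    have least: "(\<gamma>, b) \<in> R" if "b \<in> ?B" for b
      unfolding \<gamma>_def using that by (intro minim_least) auto
    have \<gamma>\<alpha>: "\<gamma> \<in> underS \<alpha>" by (rule underS_trans(2)[OF wo least[OF \<delta>B] \<delta>(1)])
    have "unbounded_below R \<gamma> (D \<alpha>)"
      unfolding unbounded_below_def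
    proof
      fix b assume b: "b \<in> underS \<gamma>"
      then have bF: "b \<in> Field R" using FS by auto
      have "(\<gamma>, b) \<notin> R" using not_in_underS_iff[OF wo bF \<gamma>(1)] b by simp
      then have "b \<notin> ?B" using least by auto
      then obtain n where "s n \<notin> underS b" using bF by auto
      then have "(b, s n) \<in> R" using not_in_underS_iff[OF wo, of "s n" b] bF s\<alpha>[of n] FS by auto
      then have "b \<in> underS (s (Suc n))" by (rule underS_trans(2)[OF wo _ sS(2)])
      then show "\<exists>c \<in> D \<alpha> \<inter> underS \<gamma>. b \<in> underS c"
        using sS(1) \<gamma>(2) by (intro bexI[of _ "s (Suc n)"]) auto
    qed
    moreover have "underS \<gamma> \<noteq> {}" using \<gamma>(2) by auto
    ultimately have \<gamma>lim: "\<gamma> \<in> Defs.Lim R (D \<alpha>)" using \<gamma>(1) by (simp add: Defs.Lim_def)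
    then have "\<gamma> \<in> ?L"
      unfolding Defs.Lim_def unbounded_below_def using club(1)[OF L] FS by fast
    then have "C \<gamma> = C \<alpha> \<inter> underS \<gamma>"
      using coh[OF L \<gamma>lim \<gamma>\<alpha>] L by (simp add: C_def)
    moreover have "K \<subseteq> underS \<gamma>"
    proof
      fix k assume "k \<in> K"
      then have "k \<in> underS \<eta>" using \<eta>(2) by auto
      moreover have "\<eta> \<in> underS \<gamma>" using \<gamma>(2) rangeI[of s 0] by (auto simp: s_def)
      ultimately show "k \<in> underS \<gamma>" by (rule underS_trans(1)[OF wo])
    qed
    ultimately show ?thesis using \<gamma>\<alpha> by (intro bexI[of _ \<gamma>]) simp_all
  qed
  have C5: "\<exists>\<alpha> \<in> Field R. \<beta> \<in> C \<alpha>" if \<beta>: "\<beta> \<in> Field R" for \<beta>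
  proof -
    let ?B = "{\<alpha> \<in> Field R. \<beta> \<in> underS \<alpha>}"
    have "?B \<noteq> {}"
      using infinite_Card_order_limit[OF CR infR \<beta>] by (auto simp: underS_def)
    \<comment> \<open>This is the successor of \<open>\<beta>\<close>, where \<open>C\<close>
      consists of the predecessor.\<close>
    define \<alpha> where "\<alpha> = minim ?B"
    have "\<alpha> \<in> ?B" unfolding \<alpha>_def using \<open>?B \<noteq> {}\<close> by (intro minim_in) auto
    then have \<alpha>: "\<alpha> \<in> Field R" "\<beta> \<in> underS \<alpha>" by auto
    have max: "\<beta> \<notin> underS c" if c: "c \<in> underS \<alpha>" for c
    proof
      assume "\<beta> \<in> underS c"
      have cF: "c \<in> Field R" using c FS by auto
      then have "(\<alpha>, c) \<in> R" unfolding \<alpha>_def using \<open>\<beta> \<in> underS c\<close> by (intro minim_least) auto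
      then show False using not_in_underS_iff[OF wo cF \<alpha>(1)] c by simp
    qed
    then have "\<alpha> \<notin> ?L"
      using \<alpha>(2) unfolding Defs.Lim_def unbounded_below_def by auto
    then have "\<beta> \<in> C \<alpha>" using \<alpha>(2) max by (simp add: C_def)
    then show ?thesis using \<alpha>(1) by (intro bexI)
  qed
  show thesis by (rule that[of C, OF C1 C2 C3 C4 C5])
qed

text \<open>The hypothesis on powers identifies \<open>Field r\<close> with the sequences in
  \<open>X\<close>, and \<open>g\<close> sends an index to the range of its sequence.\<close>

lemma countable_subsets_enumeration:
  assumes ne: "X \<noteq> {}" and pow: "|X| ^c natLeq =o r" and r: "Card_order r"
  shows "\<exists>g. (\<forall>\<beta> \<in> Field r. countable (g \<beta>) \<and> g \<beta> \<subseteq> X) \<and>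
    (\<forall>A. A \<subseteq> X \<and> countable A \<longrightarrow> (\<exists>\<beta> \<in> Field r. A \<subseteq> g \<beta>))"
proof -
  have "|Func (UNIV :: nat set) X| =o r"
    using pow by (simp add: cexp_def Field_natLeq Field_card_of)
  then have "|Field r| =o |Func (UNIV :: nat set) X|"
    using card_of_Field_ordIso[OF r] ordIso_symmetric ordIso_transitive by metis
  then obtain h where h: "bij_betw h (Field r) (Func (UNIV :: nat set) X)"
    using card_of_ordIso by metis
  show ?thesis
  proof (intro exI[of _ "\<lambda>\<beta>. range (h \<beta>)"] conjI ballI allI impI; (elim conjE)?)
    fix \<beta> assume "\<beta> \<in> Field r"
    then have "h \<beta> \<in> Func UNIV X" using h by (auto simp: bij_betw_def)
    then show "countable (range (h \<beta>))" "range (h \<beta>) \<subseteq> X" by (auto simp: Func_def)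
  next
    fix A assume A: "A \<subseteq> X" "countable A"
    obtain x where x: "x \<in> X" using ne by auto
    \<comment> \<open>The extra point \<open>x\<close> makes the set nonempty, so that it is the
      range of a sequence even if \<open>A\<close> is empty.\<close>
    let ?f = "from_nat_into (insert x A)"
    have range: "range ?f = insert x A" by (rule range_from_nat_into) (use A in auto)
    have "?f n \<in> X" for n using rangeI[of ?f n] range A(1) x by auto
    then have "?f \<in> Func UNIV X" by (simp add: Func_def)
    then have "?f \<in> h ` Field r" using h by (simp add: bij_betw_def)
    then obtain \<beta> where "\<beta> \<in> Field r" "h \<beta> = ?f" by (elim imageE) simp
    then show "\<exists>\<beta> \<in> Field r. A \<subseteq> range (h \<beta>)" using range by (intro bexI[of _ \<beta>]) auto
  qed
qed

lemma countable_ordLeq_infinite: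
  assumes "countable V" "infinite T"
  shows "|V| \<le>o |T|"
proof -
  obtain f :: "_ \<Rightarrow> nat" where "inj_on f V" using assms(1) by (rule countableE)
  then have "|V| \<le>o |UNIV :: nat set|" by (rule card_of_ordLeqI) simp
  then show ?thesis using assms(2) infinite_iff_card_of_nat ordLeq_transitive by metis
qed

text \<open>Indices below the successor of \<open>|X|\<close> enumerate countable sets
  \<open>g \<beta>\<close> covering all countable subsets of \<open>X\<close>. The sets
  \<open>Z \<alpha> n\<close> gather them along the ladder while staying of size at most
  \<open>|T n|\<close>, so the induction hypothesis applies to each.\<close>

lemma extendable_square:
  fixes X :: "'a set"
  assumes unc: "uncountable X" and cc: "ccof |X| X" and sq: "square |X|"
    and pow: "|X| ^c natLeq =o cardSuc |X|"
    and IH: "\<And>Y :: 'a set. |Y| <o |X| \<Longrightarrow> extendable {Y}"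
  shows "extendable {X}"
proof -
  define R where "R = cardSuc |X|"
  have CR: "Card_order R" unfolding R_def by (rule cardSuc_Card_order[OF card_of_Card_order])
  then have wo: "Well_order R" by (simp add: card_order_on_def)
  then interpret wo_rel R by (simp add: wo_rel_def)
  obtain C :: "'a set \<Rightarrow> 'a set set" where
    C1: "\<And>\<alpha>. \<alpha> \<in> Field R \<Longrightarrow> C \<alpha> \<subseteq> underS \<alpha>"
    and C2: "\<And>\<alpha> \<beta>. \<alpha> \<in> Field R \<Longrightarrow> \<beta> \<in> underS \<alpha> \<Longrightarrow> \<exists>\<gamma> \<in> C \<alpha>. (\<beta>, \<gamma>) \<in> R"
    and C3: "\<And>\<alpha>. \<alpha> \<in> Field R \<Longrightarrow> |C \<alpha>| <o |X|"
    and C4: "\<And>\<alpha> K. \<alpha> \<in> Field R \<Longrightarrow> \<not> ccof R (underS \<alpha>) \<Longrightarrow> countable K \<Longrightarrow> K \<subseteq> underS \<alpha> \<Longrightarrow>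
      \<exists>\<gamma> \<in> underS \<alpha>. K \<subseteq> underS \<gamma> \<and> C \<gamma> = C \<alpha> \<inter> underS \<gamma>"
    and C5: "\<And>\<beta>. \<beta> \<in> Field R \<Longrightarrow> \<exists>\<alpha> \<in> Field R. \<beta> \<in> C \<alpha>"
    using square_ladder[OF unc cc sq, folded R_def] by blast
  obtain T :: "nat \<Rightarrow> 'a set" where T: "X = (\<Union>n. T n)" "mono T" "\<And>n. infinite (T n)"
    "\<And>n. |T n| <o |X|"
    using ccof_filtration[OF unc cc] by metis
  have ne: "X \<noteq> {}" using unc by auto
  obtain g where "(\<forall>\<beta> \<in> Field R. countable (g \<beta>) \<and> g \<beta> \<subseteq> X) \<and>
      (\<forall>A. A \<subseteq> X \<and> countable A \<longrightarrow> (\<exists>\<beta> \<in> Field R. A \<subseteq> g \<beta>))"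
    using countable_subsets_enumeration[OF ne pow[folded R_def] CR] by (elim exE)
  then have g: "\<And>\<beta>. \<beta> \<in> Field R \<Longrightarrow> countable (g \<beta>) \<and> g \<beta> \<subseteq> X"
    and gsurj: "\<And>A. A \<subseteq> X \<Longrightarrow> countable A \<Longrightarrow> \<exists>\<beta> \<in> Field R. A \<subseteq> g \<beta>"
    by simp_all
  \<comment> \<open>The condition on \<open>|C \<alpha>|\<close> keeps \<open>Z \<alpha> n\<close>
    at size at most \<open>|T n|\<close>; it holds for all large \<open>n\<close>. Intersecting with
    \<open>underS \<alpha>\<close> makes the recursion well-founded at every argument.\<close>
  define Z where "Z = worec (\<lambda>Z \<alpha> n.
    if |C \<alpha>| \<le>o |T n| then \<Union>\<beta> \<in> C \<alpha> \<inter> underS \<alpha>. Z \<beta> n \<union> g \<beta> else {})"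
  have Z0: "Z \<alpha> n = (if |C \<alpha>| \<le>o |T n| then \<Union>\<beta> \<in> C \<alpha> \<inter> underS \<alpha>. Z \<beta> n \<union> g \<beta> else {})" for \<alpha> n
  proof -
    have "adm_wo (\<lambda>Z \<alpha> n. if |C \<alpha>| \<le>o |T n| then \<Union>\<beta> \<in> C \<alpha> \<inter> underS \<alpha>. Z \<beta> n \<union> g \<beta> else {})"
      unfolding adm_wo_def by (intro allI impI ext if_cong SUP_cong refl) auto
    then show ?thesis unfolding Z_def by (subst worec_fixpoint) simp_all
  qed
  have Z: "Z \<alpha> n = (if |C \<alpha>| \<le>o |T n| then \<Union>\<beta> \<in> C \<alpha>. Z \<beta> n \<union> g \<beta> else {})" if "\<alpha> \<in> Field R" for \<alpha> n
    using Z0[of \<alpha> n] C1[OF that] by (simp add: Int_absorb2)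
  have FS: "\<beta> \<in> Field R" if "\<beta> \<in> underS \<alpha>" for \<alpha> \<beta> using that underS_subset_Field[of R \<alpha>] by auto
  have ind: "P \<alpha>" if "\<alpha> \<in> Field R" and *: "\<And>\<alpha>. \<alpha> \<in> Field R \<Longrightarrow> (\<And>\<beta>. \<beta> \<in> underS \<alpha> \<Longrightarrow> P \<beta>) \<Longrightarrow> P \<alpha>" for P \<alpha>
  proof -
    have "\<alpha> \<in> Field R \<longrightarrow> P \<alpha>"
    proof (induction \<alpha> rule: well_order_induct)
      case (1 \<alpha>)
      then show ?case using *[of \<alpha>] FS by (auto simp: underS_def)
    qed
    then show ?thesis using that(1) by simp
  qed
  have ZX: "Z \<alpha> n \<subseteq> X" if "\<alpha> \<in> Field R" for \<alpha> n
    using that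
  proof (rule ind)
    fix \<alpha> assume \<alpha>: "\<alpha> \<in> Field R" and IH: "\<And>\<beta>. \<beta> \<in> underS \<alpha> \<Longrightarrow> Z \<beta> n \<subseteq> X"
    have "Z \<beta> n \<union> g \<beta> \<subseteq> X" if "\<beta> \<in> C \<alpha>" for \<beta>
      using IH[of \<beta>] g[of \<beta>] FS[of \<beta> \<alpha>] C1[OF \<alpha>] that by auto
    then show "Z \<alpha> n \<subseteq> X" by (auto simp: Z[OF \<alpha>] split: if_splits)
  qed
  have Zcard: "|Z \<alpha> n| \<le>o |T n|" if "\<alpha> \<in> Field R" for \<alpha> n
    using that
  proof (rule ind)
    fix \<alpha> assume \<alpha>: "\<alpha> \<in> Field R" and IH: "\<And>\<beta>. \<beta> \<in> underS \<alpha> \<Longrightarrow> |Z \<beta> n| \<le>o |T n|"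
    have *: "|Z \<beta> n \<union> g \<beta>| \<le>o |T n|" if "\<beta> \<in> C \<alpha>" for \<beta>
    proof (rule card_of_Un_ordLeq_infinite_Field)
      have \<beta>: "\<beta> \<in> underS \<alpha>" using C1[OF \<alpha>] that by auto
      then show "|Z \<beta> n| \<le>o |T n|" by (rule IH)
      show "|g \<beta>| \<le>o |T n|"
        by (rule countable_ordLeq_infinite) (use g[OF FS[OF \<beta>]] T(3) in auto)
    qed (use T(3) in \<open>simp_all add: Field_card_of card_of_card_order_on\<close>)
    show "|Z \<alpha> n| \<le>o |T n|"
    proof (cases "|C \<alpha>| \<le>o |T n|")
      case True
      have "|\<Union>\<beta> \<in> C \<alpha>. Z \<beta> n \<union> g \<beta>| \<le>o |T n|"
        by (rule card_of_UNION_ordLeq_infinite[OF T(3) True]) (use * in auto)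
      then show ?thesis using True by (simp add: Z[OF \<alpha>])
    next
      case False
      then show ?thesis by (simp add: Z[OF \<alpha>] card_of_empty)
    qed
  qed
  have Cmono: "|C \<alpha>| \<le>o |T m|" if "|C \<alpha>| \<le>o |T n|" "n \<le> m" for \<alpha> n m
    using that(1) card_of_mono1[OF monoD[OF T(2) that(2)]] by (rule ordLeq_transitive)
  have Zmono: "Z \<alpha> n \<subseteq> Z \<alpha> m" if "\<alpha> \<in> Field R" "n \<le> m" for \<alpha> n m
    using that(1)
  proof (rule ind)
    fix \<alpha> assume \<alpha>: "\<alpha> \<in> Field R" and IH: "\<And>\<beta>. \<beta> \<in> underS \<alpha> \<Longrightarrow> Z \<beta> n \<subseteq> Z \<beta> m"
    show "Z \<alpha> n \<subseteq> Z \<alpha> m"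
    proof (cases "|C \<alpha>| \<le>o |T n|")
      case True
      moreover have "(\<Union>\<beta> \<in> C \<alpha>. Z \<beta> n \<union> g \<beta>) \<subseteq> (\<Union>\<beta> \<in> C \<alpha>. Z \<beta> m \<union> g \<beta>)"
        by (intro UN_mono Un_mono IH order_refl) (use C1[OF \<alpha>] in auto)
      ultimately show ?thesis using Cmono[OF True that(2)] by (simp add: Z[OF \<alpha>])
    qed (simp add: Z[OF \<alpha>])
  qed
  have Cn: "\<exists>n. |C \<alpha>| \<le>o |T n|" if "\<alpha> \<in> Field R" for \<alpha>
    using ordLeq_filtration[OF T(1) T(3) C3[OF that]] .
  have ZC: "Z \<beta> n \<union> g \<beta> \<subseteq> Z \<alpha> n" if "\<alpha> \<in> Field R" "|C \<alpha>| \<le>o |T n|" "\<beta> \<in> C \<alpha>" for \<alpha> \<beta> n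
    using that by (auto simp: Z[OF that(1)])
  \<comment> \<open>Earlier sets are absorbed by later ones, possibly at a larger level. Hence a
    countable cofinal set of indices dominates all earlier stages.\<close>
  have Zinc: "\<forall>\<beta> \<in> underS \<alpha>. \<exists>m. Z \<beta> n \<subseteq> Z \<alpha> m" if "\<alpha> \<in> Field R" for \<alpha> n
    using that
  proof (rule ind)
    fix \<alpha> assume \<alpha>: "\<alpha> \<in> Field R"
      and IH: "\<And>\<gamma>. \<gamma> \<in> underS \<alpha> \<Longrightarrow> \<forall>\<beta> \<in> underS \<gamma>. \<exists>m. Z \<beta> n \<subseteq> Z \<gamma> m"
    show "\<forall>\<beta> \<in> underS \<alpha>. \<exists>m. Z \<beta> n \<subseteq> Z \<alpha> m"
    proof
      fix \<beta> assume \<beta>: "\<beta> \<in> underS \<alpha>"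
      obtain \<gamma> where \<gamma>: "\<gamma> \<in> C \<alpha>" "(\<beta>, \<gamma>) \<in> R" using C2[OF \<alpha> \<beta>] by (elim bexE)
      then have \<gamma>\<alpha>: "\<gamma> \<in> underS \<alpha>" using C1[OF \<alpha>] by auto
      have "\<exists>k. Z \<beta> n \<subseteq> Z \<gamma> k"
      proof (cases "\<beta> = \<gamma>")
        case False
        then have "\<beta> \<in> underS \<gamma>" using \<gamma>(2) by (simp add: underS_def)
        then show ?thesis using IH[OF \<gamma>\<alpha>] by (rule bspec[rotated])
      qed auto
      then obtain k where k: "Z \<beta> n \<subseteq> Z \<gamma> k" ..
      obtain l where l: "|C \<alpha>| \<le>o |T l|" using Cn[OF \<alpha>] ..
      have "Z \<gamma> k \<subseteq> Z \<gamma> (max k l)" by (rule Zmono[OF FS[OF \<gamma>\<alpha>]]) simp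
      also have "\<dots> \<subseteq> Z \<alpha> (max k l)"
        using ZC[OF \<alpha> Cmono[OF l, of "max k l"] \<gamma>(1)] by simp
      finally show "\<exists>m. Z \<beta> n \<subseteq> Z \<alpha> m" using k by (intro exI[of _ "max k l"]) auto
    qed
  qed
  have "extendable (\<Union>\<alpha> \<in> Field R. range (Z \<alpha>))"
  proof (rule extendable_chain[OF wo])
    fix \<alpha> assume \<alpha>: "\<alpha> \<in> Field R"
    show "extendable (range (Z \<alpha>)) \<and>
        (\<exists>K. countable K \<and> K \<subseteq> underS \<alpha> \<and>
          (\<forall>j \<in> underS \<alpha>. \<exists>k \<in> K. \<forall>X \<in> range (Z j). \<exists>X' \<in> range (Z k). X \<subseteq> X')) \<or>
      (\<forall>X \<in> range (Z \<alpha>). \<forall>A. A \<subseteq> X \<and> countable A \<longrightarrow>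
          (\<exists>j \<in> underS \<alpha>. \<exists>X' \<in> range (Z j). A \<subseteq> X'))" (is "?ext \<and> ?K \<or> ?cover")
    proof (cases "ccof R (underS \<alpha>)")
      case True
      then obtain K where K: "countable K" "K \<subseteq> underS \<alpha>" "\<forall>a \<in> underS \<alpha>. \<exists>k \<in> K. (a, k) \<in> R"
        unfolding ccof_def by (elim exE conjE)
      have "\<exists>k \<in> K. \<forall>X \<in> range (Z j). \<exists>X' \<in> range (Z k). X \<subseteq> X'" if j: "j \<in> underS \<alpha>" for j
      proof -
        obtain k where k: "k \<in> K" "(j, k) \<in> R" using K(3) j by meson
        have sub: "\<exists>m. Z j n \<subseteq> Z k m" for n
        proof (cases "j = k")
          case False
          then have "j \<in> underS k" using k(2) by (simp add: underS_def)
          then show ?thesis using Zinc[of k n] FS K(2) k(1) by (meson subsetD)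
        qed auto
        have "\<forall>X \<in> range (Z j). \<exists>X' \<in> range (Z k). X \<subseteq> X'"
        proof
          fix V assume "V \<in> range (Z j)"
          then obtain n where "V = Z j n" by (elim imageE)
          then show "\<exists>X' \<in> range (Z k). V \<subseteq> X'" using sub[of n] by auto
        qed
        then show ?thesis using k(1) by (rule bexI)
      qed
      then have ?K using K(1,2) by (intro exI[of _ K] conjI ballI)
      moreover have ?ext
        by (intro extendable_seq IH ordLeq_ordLess_trans[OF Zcard[OF \<alpha>] T(4)])
      ultimately show ?thesis by (intro disjI1 conjI)
    next
      case False
      have "\<exists>j \<in> underS \<alpha>. \<exists>X' \<in> range (Z j). A \<subseteq> X'" if A: "A \<subseteq> Z \<alpha> n" "countable A" for A n
      proof -
        have "\<exists>\<gamma> \<in> underS \<alpha>. A \<subseteq> Z \<gamma> n"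
        proof (cases "|C \<alpha>| \<le>o |T n|")
          case True
          \<comment> \<open>Each point of \<open>A\<close> entered through some ladder index
            \<open>b a\<close>. A \<open>\<gamma>\<close> above all of these, with
            \<open>C \<gamma>\<close> an initial piece of \<open>C \<alpha>\<close>, passes the same
            size condition and so collects all of \<open>A\<close> at the same level
            \<open>n\<close>.\<close>
          have "\<exists>\<beta>. \<beta> \<in> C \<alpha> \<and> a \<in> Z \<beta> n \<union> g \<beta>" if "a \<in> A" for a
            using A(1) that True by (auto simp: Z[OF \<alpha>])
          then obtain b where b: "\<And>a. a \<in> A \<Longrightarrow> b a \<in> C \<alpha> \<and> a \<in> Z (b a) n \<union> g (b a)" by metis
          have "\<exists>\<gamma> \<in> underS \<alpha>. b ` A \<subseteq> underS \<gamma> \<and> C \<gamma> = C \<alpha> \<inter> underS \<gamma>"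
            by (rule C4[OF \<alpha> False]) (use A(2) b C1[OF \<alpha>] in auto)
          then obtain \<gamma> where \<gamma>: "\<gamma> \<in> underS \<alpha>" "b ` A \<subseteq> underS \<gamma>" "C \<gamma> = C \<alpha> \<inter> underS \<gamma>"
            by (elim bexE conjE)
          have le: "|C \<gamma>| \<le>o |T n|"
            by (rule ordLeq_transitive[OF card_of_mono1 True]) (simp add: \<gamma>(3))
          have "a \<in> Z \<gamma> n" if a: "a \<in> A" for a
          proof -
            have "b a \<in> C \<gamma>" using b[OF a] \<gamma>(2,3) a by auto
            then show ?thesis using ZC[OF FS[OF \<gamma>(1)] le] b[OF a] by auto
          qed
          then show ?thesis using \<gamma>(1) by (intro bexI[of _ \<gamma>] subsetI)
        next
          \<comment> \<open>Now \<open>Z \<alpha> n\<close> is empty, and any index below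
            \<open>\<alpha>\<close> will do; one exists since the empty set is not cofinal.\<close>
          case nle: False
          have "\<exists>\<gamma> \<in> underS \<alpha>. {} \<subseteq> underS \<gamma>"
            by (rule not_ccofD[OF wo underS_subset_Field False]) simp_all
          then show ?thesis using A(1) nle by (simp add: Z[OF \<alpha>])
        qed
        then show ?thesis by (meson rangeI)
      qed
      then have ?cover by (intro ballI allI impI) (elim imageE conjE, simp)
      then show ?thesis ..
    qed
  qed simp
  then show ?thesis
  proof (rule extendable_cover)
    show "X' \<subseteq> X" if "X' \<in> (\<Union>\<alpha> \<in> Field R. range (Z \<alpha>))" for X'
      using that ZX by auto
  next
    fix A assume "A \<subseteq> X" "countable A"
    then obtain \<beta> where \<beta>: "\<beta> \<in> Field R" "A \<subseteq> g \<beta>" using gsurj by meson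
    obtain \<alpha> where \<alpha>: "\<alpha> \<in> Field R" "\<beta> \<in> C \<alpha>" using C5[OF \<beta>(1)] by (elim bexE)
    obtain n where "|C \<alpha>| \<le>o |T n|" using Cn[OF \<alpha>(1)] ..
    then have "A \<subseteq> Z \<alpha> n" using ZC[OF \<alpha>(1) _ \<alpha>(2)] \<beta>(2) by auto
    then show "\<exists>X' \<in> (\<Union>\<alpha> \<in> Field R. range (Z \<alpha>)). A \<subseteq> X'" using \<alpha>(1) by blast
  qed
qed

section \<open>Induction on cardinality and the two hypotheses on the cardinal\<close>

text \<open>Well-founded induction on \<open>|X|\<close>; the hypothesis \<open>sing\<close> is
  called on exactly for uncountable \<open>X\<close> of countable cofinality.\<close>

lemma extendable_ordLeq:
  fixes lam :: "'a rel"
  assumes sing: "\<And>X :: 'a set. |X| \<le>o lam \<Longrightarrow> uncountable X \<Longrightarrow> ccof |X| X \<Longrightarrow>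
      |X| ^c natLeq =o cardSuc |X| \<and> square |X|"
    and X: "|X :: 'a set| \<le>o lam"
  shows "extendable {X}"
proof -
  have "|X| \<le>o lam \<longrightarrow> extendable {X}" for X :: "'a set"
  proof (induction X rule: wf_induct[OF wf_inv_image[OF wf_ordLess, of card_of]])
    case (1 X)
    have IH: "extendable {Y}" if "|Y| <o |X|" "|X| \<le>o lam" for Y :: "'a set"
    proof -
      have "|Y| \<le>o lam" using ordLess_imp_ordLeq[OF ordLess_ordLeq_trans[OF that]] .
      moreover have "(Y, X) \<in> inv_image ordLess card_of" using that(1) by simp
      ultimately show ?thesis using 1[THEN spec[of _ Y]] by simp
    qed
    show ?case
    proof
      assume le: "|X| \<le>o lam"
      consider "countable X" | "\<not> ccof |X| X" | "uncountable X" "ccof |X| X" by auto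
      then show "extendable {X}"
      proof cases
        case 1 then show ?thesis by (rule extendable_countable)
      next
        case 2 show ?thesis by (rule extendable_not_ccof[OF IH[OF _ le] 2])
      next
        case 3
        have "square |X|" "|X| ^c natLeq =o cardSuc |X|" using sing[OF le 3] by simp_all
        then show ?thesis by (rule extendable_square[OF 3 _ _ IH[OF _ le]])
      qed
    qed
  qed
  then show ?thesis using X by simp
qed

text \<open>A countable filtration by smaller sets contradicts stability, because its index set is
  smaller than \<open>X\<close> as well.\<close>

lemma stable_not_ccof:
  assumes st: "stable |X|" and unc: "uncountable X"
  shows "\<not> ccof |X| X"
proof
  assume "ccof |X| X"
  then obtain T :: "nat \<Rightarrow> 'a set" where T: "X = (\<Union>n. T n)" "\<And>n. |T n| <o |X|"
    using ccof_filtration[OF unc] by metis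
  have "|\<Union>n \<in> UNIV. T n| <o |X|"
    by (rule stable_UNION[OF st countable_ordLess_uncountable[OF _ unc] T(2)]) simp
  then show False using T(1) ordLess_irreflexive by metis
qed

text \<open>\<open>natLeq\<close> is stable, and successors of infinite cardinals are
  regular.\<close>

lemma is_aleph_stable:
  fixes s :: "'a rel"
  assumes "is_aleph n s"
  shows "Card_order s \<and> infinite (Field s) \<and> stable s"
proof -
  have inf: "Card_order s \<and> natLeq \<le>o s" if "is_aleph n s" for n and s :: "'a rel"
    using that
  proof (induction n arbitrary: s)
    case 0 then show ?case by (auto intro: ordIso_imp_ordLeq ordIso_symmetric)
  next
    case (Suc n)
    then obtain t :: "'a rel" where t: "is_aleph n t" "s =o cardSuc t" "Card_order s" by auto
    then have "Card_order t" "natLeq \<le>o t" using Suc.IH by auto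
    then have "natLeq \<le>o cardSuc t" using cardSuc_ordLeq ordLeq_transitive by metis
    then show ?case using t(2,3) ordLeq_ordIso_trans ordIso_symmetric by metis
  qed
  have infF: "infinite (Field s)" if "is_aleph n s" for n and s :: "'a rel"
  proof -
    have "natLeq \<le>o |Field s|"
      using inf[OF that] card_of_Field_ordIso ordIso_symmetric ordLeq_ordIso_trans by metis
    then show ?thesis using infinite_iff_natLeq_ordLeq by auto
  qed
  have "stable s"
  proof (cases n)
    case 0
    then have "s =o natLeq" using assms by simp
    then show ?thesis by (rule stable_ordIso1[OF stable_natLeq])
  next
    case (Suc m)
    then obtain t :: "'a rel" where t: "is_aleph m t" "s =o cardSuc t" using assms by auto
    then have t': "Card_order t" "infinite (Field t)" using inf infF by auto
    then have "stable (cardSuc t)"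
      by (intro regularCard_stable cardSuc_Card_order infinite_cardSuc_regularCard)
        (simp_all add: cardSuc_finite)
    then show ?thesis using t(2) by (rule stable_ordIso1)
  qed
  then show ?thesis using inf[OF assms] infF[OF assms] by simp
qed

text \<open>Descent on \<open>n\<close>: below a successor \<open>cardSuc t\<close> one is at most
  \<open>t\<close>, and below \<open>natLeq\<close> there are no infinite cardinals. So every
  infinite cardinal below \<omega>_\<omega> is regular.\<close>

lemma below_aleph_stable:
  fixes s :: "'a rel" and r :: "'b rel"
  assumes "is_aleph n s" "Card_order r" "infinite (Field r)" "r <o s"
  shows "stable r"
  using assms(1,4)
proof (induction n arbitrary: s)
  case 0
  then have "r <o natLeq" using ordLess_ordIso_trans by auto
  then have "|Field r| <o natLeq"
    using card_of_Field_ordIso[OF assms(2)] ordIso_ordLess_trans by metis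
  then show ?case using assms(3) by (simp add: finite_iff_ordLess_natLeq)
next
  case (Suc n)
  then obtain t :: "'a rel" where t: "is_aleph n t" "s =o cardSuc t" by auto
  have "r <o cardSuc t" using Suc.prems(2) t(2) by (rule ordLess_ordIso_trans)
  then have "r \<le>o t"
    using cardSuc_ordLeq_ordLess[OF _ assms(2)] is_aleph_stable[OF t(1)] by auto
  then consider "r <o t" | "r =o t" by (auto simp: ordLeq_iff_ordLess_or_ordIso)
  then show ?case
  proof cases
    case 1 then show ?thesis by (rule Suc.IH[OF t(1)])
  next
    case 2 then show ?thesis using stable_ordIso1 is_aleph_stable[OF t(1)] by metis
  qed
qed

text \<open>Under the first alternative the singular case cannot occur, by stability; under the
  second the hypothesis at \<open>|X|\<close> supplies it. The extension then starts from the empty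
  family.\<close>

lemma full_coherent_exists:
  fixes lam :: "'a rel"
  assumes lam: "Card_order lam"
    and hyp: "below_aleph_omega lam \<or>
      (\<forall>\<mu> :: 'a rel. Card_order \<mu> \<and> \<mu> \<le>o lam \<and> cf \<mu> =o natLeq \<and> natLeq <o \<mu> \<longrightarrow>
        \<mu> ^c natLeq =o cardSuc \<mu> \<and> square \<mu>)"
  shows "\<exists>E. coherent E \<and> full (Field lam) E"
proof -
  have sing: "|X| ^c natLeq =o cardSuc |X| \<and> square |X|"
    if X: "|X| \<le>o lam" "uncountable X" "ccof |X| X" for X :: "'a set"
  proof -
    have inf: "infinite X" using X(2) countable_finite by auto
    have "\<not> below_aleph_omega lam"
    proof
      assume "below_aleph_omega lam"
      then obtain n and s :: "'a set rel" where s: "is_aleph n s" "lam <o s"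
        unfolding below_aleph_omega_def by auto
      have "stable |X|"
        by (rule below_aleph_stable[OF s(1) card_of_Card_order _ ordLeq_ordLess_trans[OF X(1) s(2)]])
          (simp add: Field_card_of inf)
      then show False using stable_not_ccof X by auto
    qed
    moreover have "natLeq <o |X|"
      using countable_ordLess_uncountable[of "UNIV :: nat set" X] X(2) card_of_nat
        ordIso_symmetric ordIso_ordLess_trans by (metis countableI_type)
    ultimately show ?thesis
      using hyp X(1) cf_of_ccof[OF inf X(3)] card_of_Card_order[of X] by blast
  qed
  have "extendable {Field lam}"
    by (rule extendable_ordLeq[OF sing ordIso_imp_ordLeq[OF card_of_Field_ordIso[OF lam]]])
  then have "\<exists>E. grows {} {Field lam} E"
    by (rule extendableD[where \<Y> = "{}"]) (auto simp: coherent_def)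
  then obtain E where E: "grows {} {Field lam} E" ..
  have "coherent E" "full (Field lam) E" using growsD(2)[OF E] growsD(3)[OF E] by simp_all
  then show ?thesis by (intro exI[of _ E] conjI)
qed

section \<open>Finite unions of increasing relations\<close>

text \<open>The equivalence, in place of an implication, makes the notion symmetric, so that it
  passes to inverses.\<close>

definition inc :: "('a \<Rightarrow> nat) \<Rightarrow> ('b \<Rightarrow> nat) \<Rightarrow> ('a \<times> 'b) set \<Rightarrow> bool" where
  "inc u v q \<longleftrightarrow> (\<forall>(x, y) \<in> q. \<forall>(x', y') \<in> q. u x < u x' \<longleftrightarrow> v y < v y')"

definition finc :: "('a \<Rightarrow> nat) \<Rightarrow> ('b \<Rightarrow> nat) \<Rightarrow> ('a \<times> 'b) set \<Rightarrow> bool" where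
  "finc u v h \<longleftrightarrow> (\<exists>Q. finite Q \<and> h = \<Union>Q \<and> (\<forall>q \<in> Q. inc u v q))"

lemma incI:
  assumes "\<And>x y x' y'. (x, y) \<in> q \<Longrightarrow> (x', y') \<in> q \<Longrightarrow> u x < u x' \<longleftrightarrow> v y < v y'"
  shows "inc u v q"
  using assms unfolding inc_def by auto

lemma incD: "inc u v q \<Longrightarrow> (x, y) \<in> q \<Longrightarrow> (x', y') \<in> q \<Longrightarrow> u x < u x' \<longleftrightarrow> v y < v y'"
  unfolding inc_def by auto

lemma inc_imp_finc: "inc u v q \<Longrightarrow> finc u v q"
  unfolding finc_def by (intro exI[of _ "{q}"]) simp

lemma finc_subset:
  assumes "finc u v h" "h' \<subseteq> h"
  shows "finc u v h'"
proof -
  obtain Q where Q: "finite Q" "h = \<Union>Q" "\<And>q. q \<in> Q \<Longrightarrow> inc u v q"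
    using assms(1) unfolding finc_def by auto
  have "h' = \<Union>((\<lambda>q. q \<inter> h') ` Q)" using Q(2) assms(2) by auto
  moreover have "inc u v (q \<inter> h')" if "q \<in> Q" for q
    by (rule incI) (use incD[OF Q(3)[OF that]] in auto)
  ultimately show ?thesis
    unfolding finc_def using Q(1) by (intro exI[of _ "(\<lambda>q. q \<inter> h') ` Q"] conjI) auto
qed

lemma finc_Un:
  assumes "finc u v h" "finc u v k"
  shows "finc u v (h \<union> k)"
proof -
  obtain Q where Q: "finite Q" "h = \<Union>Q" "\<forall>q \<in> Q. inc u v q"
    using assms(1) unfolding finc_def by auto
  obtain P where P: "finite P" "k = \<Union>P" "\<forall>q \<in> P. inc u v q"
    using assms(2) unfolding finc_def by auto
  show ?thesis
    unfolding finc_def using P Q by (intro exI[of _ "Q \<union> P"]) auto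
qed

lemma finc_UN:
  assumes "finite I" "\<And>i. i \<in> I \<Longrightarrow> finc u v (h i)"
  shows "finc u v (\<Union>i \<in> I. h i)"
  using assms
proof (induction I)
  case empty
  show ?case by (rule inc_imp_finc) (simp add: inc_def)
next
  case (insert i I)
  then show ?case by (simp add: finc_Un)
qed

lemma finc_finite:
  assumes "finite h"
  shows "finc u v h"
proof -
  have "finc u v (\<Union>p \<in> h. {p})"
    using assms by (rule finc_UN) (auto intro!: inc_imp_finc simp: inc_def)
  then show ?thesis by simp
qed

text \<open>Composition distributes over unions, and a composite of two increasing pieces is
  increasing.\<close>

lemma finc_relcomp:
  assumes "finc u v h" "finc v w k"
  shows "finc u w (h O k)"
proof -
  obtain Q where Q: "finite Q" "h = \<Union>Q" "\<And>q. q \<in> Q \<Longrightarrow> inc u v q"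
    using assms(1) unfolding finc_def by auto
  obtain P where P: "finite P" "k = \<Union>P" "\<And>p. p \<in> P \<Longrightarrow> inc v w p"
    using assms(2) unfolding finc_def by auto
  have "finc u w (\<Union>(q, p) \<in> Q \<times> P. q O p)"
  proof (rule finc_UN)
    fix z assume "z \<in> Q \<times> P"
    then obtain q p where z: "z = (q, p)" "q \<in> Q" "p \<in> P" by auto
    have "inc u w (q O p)"
      by (rule incI) (use incD[OF Q(3)[OF z(2)]] incD[OF P(3)[OF z(3)]] in auto)
    then show "finc u w (case z of (q, p) \<Rightarrow> q O p)" by (simp add: z(1) inc_imp_finc)
  qed (use P Q in auto)
  moreover have "(\<Union>(q, p) \<in> Q \<times> P. q O p) = h O k" using P(2) Q(2) by auto
  ultimately show ?thesis by simp
qed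

lemma finc_converse:
  assumes "finc u v h"
  shows "finc v u (h\<inverse>)"
proof -
  obtain Q where Q: "finite Q" "h = \<Union>Q" "\<And>q. q \<in> Q \<Longrightarrow> inc u v q"
    using assms unfolding finc_def by auto
  have "finc v u (\<Union>q \<in> Q. q\<inverse>)"
  proof (rule finc_UN[OF Q(1)])
    fix q assume "q \<in> Q"
    then show "finc v u (q\<inverse>)"
      by (intro inc_imp_finc incI) (use incD[OF Q(3)] in auto)
  qed
  then show ?thesis using Q(2) by (auto simp: converse_UNION[symmetric])
qed

section \<open>From finite-to-one functions to injections\<close>

text \<open>Each \<open>v A\<close> orders \<open>A\<close> in type at most \<omega>. The second
  clause says that passing from one such order to another costs only finitely many increasing
  pieces.\<close>

definition coherent_inj :: "'a set \<Rightarrow> ('a set \<Rightarrow> 'a \<Rightarrow> nat) \<Rightarrow> bool" where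
  "coherent_inj L v \<longleftrightarrow>
     (\<forall>A. A \<subseteq> L \<and> countable A \<longrightarrow> inj_on (v A) A) \<and>
     (\<forall>A B. A \<subseteq> L \<and> countable A \<and> B \<subseteq> L \<and> countable B \<longrightarrow> finc (v A) (v B) (Id_on (A \<inter> B)))"

text \<open>A finite-to-one function is turned into an injection by breaking ties along one well-order
  of the whole type: on a set where two functions agree, so do the resulting orders.\<close>

definition tie_less :: "('a \<Rightarrow> nat) \<Rightarrow> 'a \<Rightarrow> 'a \<Rightarrow> bool" where
  "tie_less f x y \<longleftrightarrow> f x < f y \<or> f x = f y \<and> x \<in> underS |UNIV :: 'a set| y"

definition rank :: "'a set \<Rightarrow> ('a \<Rightarrow> nat) \<Rightarrow> 'a \<Rightarrow> nat" where
  "rank A f x = card {z \<in> A. tie_less f z x}"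

lemma tie_less_linear:
  shows "tie_less f x y \<Longrightarrow> tie_less f y z \<Longrightarrow> tie_less f x z"
    and "\<not> tie_less f x x"
    and "x \<noteq> y \<Longrightarrow> tie_less f x y \<or> tie_less f y x"
proof -
  have wo: "Well_order |UNIV :: 'a set|" by (rule card_of_Well_order)
  show "tie_less f x y \<Longrightarrow> tie_less f y z \<Longrightarrow> tie_less f x z"
    unfolding tie_less_def using underS_trans(1)[OF wo, of x y z] by auto
  show "\<not> tie_less f x x" by (simp add: tie_less_def underS_def)
  show "x \<noteq> y \<Longrightarrow> tie_less f x y \<or> tie_less f y x"
    unfolding tie_less_def
    using not_in_underS_iff[OF wo, of x y] by (auto simp: Field_card_of underS_def)
qed

text \<open>Finite fibres give every point finitely many predecessors in the tie-broken order, so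
  counting them is strictly monotone.\<close>

lemma rank_less_iff:
  assumes fin: "\<And>k. finite {x \<in> A. f x = k}" and xy: "x \<in> A" "y \<in> A"
  shows "rank A f x < rank A f y \<longleftrightarrow> tie_less f x y"
proof -
  have "finite {z \<in> A. tie_less f z a}" for a
  proof (rule finite_subset)
    show "{z \<in> A. tie_less f z a} \<subseteq> (\<Union>k \<le> f a. {x \<in> A. f x = k})" by (auto simp: tie_less_def)
  qed (use fin in simp)
  moreover have "{z \<in> A. tie_less f z a} \<subset> {z \<in> A. tie_less f z b}"
    if "a \<in> A" "tie_less f a b" for a b
  proof
    show "{z \<in> A. tie_less f z a} \<subseteq> {z \<in> A. tie_less f z b}"
      using tie_less_linear(1)[OF _ that(2)] by auto
    show "{z \<in> A. tie_less f z a} \<noteq> {z \<in> A. tie_less f z b}"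
      using that tie_less_linear(2)[of f a] by auto
  qed
  ultimately have *: "rank A f a < rank A f b" if "a \<in> A" "tie_less f a b" for a b
    unfolding rank_def using that by (intro psubset_card_mono) simp_all
  show ?thesis
  proof (cases "x = y")
    case False
    then show ?thesis using *[OF xy(1), of y] *[OF xy(2), of x] tie_less_linear(3)[OF False] by fastforce
  qed (simp add: tie_less_linear(2))
qed

text \<open>Where \<open>e A\<close> and \<open>e B\<close> agree, the tie-broken orders agree and
  the identity is increasing. The finitely many remaining points contribute a finite
  relation.\<close>

lemma coherent_inj_exists:
  assumes E: "coherent E" and full: "full L E"
  shows "\<exists>v. coherent_inj L v"
proof -
  obtain e where e: "\<And>A. A \<subseteq> L \<Longrightarrow> countable A \<Longrightarrow> (A, e A) \<in> E"
    using full unfolding full_def by metis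
  define v where "v A = rank A (e A)" for A
  have v: "v A x < v A y \<longleftrightarrow> tie_less (e A) x y"
    if "A \<subseteq> L" "countable A" "x \<in> A" "y \<in> A" for A x y
    unfolding v_def by (rule rank_less_iff[OF coherentD(2)[OF E e[OF that(1,2)]] that(3,4)])
  have "inj_on (v A) A" if A: "A \<subseteq> L" "countable A" for A
  proof (rule inj_onI, rule ccontr)
    fix x y assume "x \<in> A" "y \<in> A" "v A x = v A y" "x \<noteq> y"
    then show False using v[OF A, of x y] v[OF A, of y x] tie_less_linear(3)[of x y "e A"] by simp
  qed
  moreover have "finc (v A) (v B) (Id_on (A \<inter> B))"
    if A: "A \<subseteq> L" "countable A" and B: "B \<subseteq> L" "countable B" for A B
  proof -
    let ?F = "{x \<in> A \<inter> B. e A x \<noteq> e B x}" and ?D = "{x \<in> A \<inter> B. e A x = e B x}"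
    have "inc (v A) (v B) (Id_on ?D)"
      by (rule incI) (auto simp: v[OF A] v[OF B] tie_less_def)
    moreover have "finite (Id_on ?F)"
      using coherentD(3)[OF E e[OF A] e[OF B]] by (simp add: Id_on_def)
    ultimately have "finc (v A) (v B) (Id_on ?D \<union> Id_on ?F)"
      by (intro finc_Un inc_imp_finc finc_finite)
    moreover have "Id_on ?D \<union> Id_on ?F = Id_on (A \<inter> B)" by auto
    ultimately show ?thesis by simp
  qed
  ultimately show ?thesis unfolding coherent_inj_def by (intro exI[of _ v]) simp
qed

section \<open>The permutation group\<close>

text \<open>The target is measured by \<open>v\<close> at the image of \<open>S\<close>, itself a
  countable set. By \<open>finc_transfer\<close> any other countable subset of \<open>L\<close>
  containing that image would give the same condition.\<close>

definition finc_group :: "'a set \<Rightarrow> ('a set \<Rightarrow> 'a \<Rightarrow> nat) \<Rightarrow> ('a \<Rightarrow> 'a) set" where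
  "finc_group L v =
     {p \<in> Bij L. \<forall>S. S \<subseteq> L \<and> countable S \<longrightarrow> finc (v S) (v (p ` S)) (graph_on S p)}"

lemma graph_on_iff: "(x, y) \<in> graph_on S f \<longleftrightarrow> x \<in> S \<and> y = f x"
  by (auto simp: graph_on_def)

text \<open>Composing with the identities between old and new measuring sets, which are
  \<open>finc\<close> by coherence, changes the sets against which a relation is measured.\<close>

lemma finc_transfer:
  assumes v: "coherent_inj L v" and h: "finc (v A) (v B) h" "h' \<subseteq> h"
    and sub: "h' \<subseteq> A \<times> B" "h' \<subseteq> A' \<times> B'"
    and L: "A \<subseteq> L" "countable A" "B \<subseteq> L" "countable B"
      "A' \<subseteq> L" "countable A'" "B' \<subseteq> L" "countable B'"
  shows "finc (v A') (v B') h'"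
proof -
  have Id: "finc (v C) (v D) (Id_on (C \<inter> D))"
    if "C \<subseteq> L" "countable C" "D \<subseteq> L" "countable D" for C D
    using v that unfolding coherent_inj_def by simp
  have "finc (v A') (v B') (Id_on (A' \<inter> A) O (h O Id_on (B \<inter> B')))"
    by (intro finc_relcomp[OF Id finc_relcomp[OF h(1) Id]] L)
  moreover have "h' \<subseteq> Id_on (A' \<inter> A) O (h O Id_on (B \<inter> B'))"
    using h(2) sub by (fastforce simp: relcomp_unfold)
  ultimately show ?thesis by (rule finc_subset)
qed

lemma finc_groupD:
  assumes "p \<in> finc_group L v"
  shows "p \<in> Bij L" "S \<subseteq> L \<Longrightarrow> countable S \<Longrightarrow> finc (v S) (v (p ` S)) (graph_on S p)"
  using assms unfolding finc_group_def by simp_all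

lemma Bij_image_subset: "p \<in> Bij L \<Longrightarrow> S \<subseteq> L \<Longrightarrow> p ` S \<subseteq> L"
  unfolding Bij_def bij_betw_def by auto

text \<open>Products and inverses correspond to composition and converse of graphs, under which
  \<open>finc\<close> is closed.\<close>

lemma permutation_group_finc_group:
  assumes v: "coherent_inj L v"
  shows "permutation_group L (finc_group L v)"
  unfolding permutation_group_def
proof (rule group.subgroupI[OF group_BijGroup])
  show "finc_group L v \<subseteq> carrier (BijGroup L)"
    by (auto simp: finc_group_def BijGroup_def)
  have "(\<lambda>x \<in> L. x) \<in> finc_group L v"
    unfolding finc_group_def
  proof (intro CollectI conjI id_Bij allI impI; elim conjE)
    fix S assume S: "S \<subseteq> L" "countable S"
    have "(\<lambda>x \<in> L. x) ` S = S" using S(1) by auto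
    moreover have "graph_on S (\<lambda>x \<in> L. x) = Id_on (S \<inter> S)" using S(1) by (auto simp: graph_on_def)
    ultimately show "finc (v S) (v ((\<lambda>x \<in> L. x) ` S)) (graph_on S (\<lambda>x \<in> L. x))"
      using v S unfolding coherent_inj_def by metis
  qed
  then show "finc_group L v \<noteq> {}" by auto
next
  fix p assume p: "p \<in> finc_group L v"
  note pB = finc_groupD(1)[OF p]
  let ?q = "\<lambda>x \<in> L. inv_into L p x"
  have q: "?q \<in> Bij L" by (rule restrict_inv_into_Bij[OF pB])
  have bij: "bij_betw p L L" using pB by (simp add: Bij_def)
  have "?q \<otimes>\<^bsub>BijGroup L\<^esub> p = \<one>\<^bsub>BijGroup L\<^esub>"
    using pB q Bij_compose_restrict_eq[OF pB] by (simp add: BijGroup_def)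
  then have inv: "inv\<^bsub>BijGroup L\<^esub> p = ?q"
    by (rule group.inv_equality[OF group_BijGroup]) (use pB q in \<open>simp_all add: BijGroup_def\<close>)
  show "inv\<^bsub>BijGroup L\<^esub> p \<in> finc_group L v"
    unfolding inv finc_group_def
  proof (intro CollectI conjI q allI impI; elim conjE)
    fix S assume S: "S \<subseteq> L" "countable S"
    have qS: "?q ` S \<subseteq> L" using Bij_image_subset[OF q S(1)] .
    have pq: "p (?q x) = x" if "x \<in> S" for x
      using that S(1) bij by (auto simp: bij_betw_def f_inv_into_f)
    then have "p ` ?q ` S = (\<lambda>x. x) ` S" unfolding image_image by (rule image_cong[OF refl])
    then have pqS: "p ` ?q ` S = S" unfolding image_ident .
    \<comment> \<open>The condition for \<open>p\<close> is taken at the preimage of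
      \<open>S\<close> and then reversed.\<close>
    have "finc (v (?q ` S)) (v (p ` ?q ` S)) (graph_on (?q ` S) p)"
      by (rule finc_groupD(2)[OF p qS countable_image[OF S(2)]])
    then have "finc (v (?q ` S)) (v S) (graph_on (?q ` S) p)" unfolding pqS .
    moreover have "(graph_on (?q ` S) p)\<inverse> = graph_on S ?q"
    proof (intro equalityI subrelI)
      fix x z assume "(x, z) \<in> (graph_on (?q ` S) p)\<inverse>"
      then have z: "z \<in> ?q ` S" "x = p z" by (simp_all only: converse_iff graph_on_iff)
      then obtain s where s: "z = ?q s" "s \<in> S" by (elim imageE)
      then have "x = s" using z(2) pq[OF s(2)] by (simp only:)
      then show "(x, z) \<in> graph_on S ?q" using s by (simp only: graph_on_iff)
    next
      fix x z assume "(x, z) \<in> graph_on S ?q"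
      then have x: "x \<in> S" "z = ?q x" by (simp_all only: graph_on_iff)
      then have "p z = x" using pq[OF x(1)] by (simp only:)
      then show "(x, z) \<in> (graph_on (?q ` S) p)\<inverse>"
        using x by (simp only: converse_iff graph_on_iff imageI)
    qed
    ultimately show "finc (v S) (v (?q ` S)) (graph_on S ?q)" by (metis finc_converse)
  qed
next
  fix p q assume p: "p \<in> finc_group L v" and q: "q \<in> finc_group L v"
  note pB = finc_groupD(1)[OF p] and qB = finc_groupD(1)[OF q]
  have mult: "p \<otimes>\<^bsub>BijGroup L\<^esub> q = compose L p q"
    using pB qB by (simp add: BijGroup_def)
  show "p \<otimes>\<^bsub>BijGroup L\<^esub> q \<in> finc_group L v"
    unfolding mult finc_group_def
  proof (intro CollectI conjI compose_Bij pB qB allI impI; elim conjE)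
    fix S assume S: "S \<subseteq> L" "countable S"
    have eq: "compose L p q x = p (q x)" if "x \<in> S" for x
      using S(1) that by (auto simp: compose_def)
    then have "compose L p q ` S = p ` q ` S" unfolding image_image by (rule image_cong[OF refl])
    moreover have "graph_on S (compose L p q) = graph_on S q O graph_on (q ` S) p"
      using eq by (auto simp: graph_on_iff relcomp_unfold)
    moreover have "finc (v S) (v (p ` q ` S)) (graph_on S q O graph_on (q ` S) p)"
      using Bij_image_subset[OF qB S(1)] S(2)
      by (intro finc_relcomp[OF finc_groupD(2)[OF q S] finc_groupD(2)[OF p]]) simp_all
    ultimately show "finc (v S) (v (compose L p q ` S)) (graph_on S (compose L p q))" by simp
  qed
qed

section \<open>Homogeneity\<close>

text \<open>The infinite set of values of \<open>v\<close> is enumerated increasingly and pulled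
  back along the injection.\<close>

lemma increasing_enumeration:
  fixes v :: "'a \<Rightarrow> nat"
  assumes "infinite S" "inj_on v S"
  shows "\<exists>b :: nat \<Rightarrow> 'a. bij_betw b UNIV S \<and> (\<forall>i j. v (b i) < v (b j) \<longleftrightarrow> i < j)"
proof -
  let ?b = "\<lambda>i. inv_into S v (enumerate (v ` S) i)"
  have inf: "infinite (v ` S)" using assms finite_imageD by blast
  have "bij_betw (inv_into S v \<circ> enumerate (v ` S)) UNIV S"
    using bij_enumerate[OF inf] bij_betw_inv_into[OF inj_on_imp_bij_betw[OF assms(2)]]
    by (rule bij_betw_trans)
  moreover have "v (?b i) = enumerate (v ` S) i" for i
    by (rule f_inv_into_f[OF enumerate_in_set[OF inf]])
  ultimately show ?thesis using inf by (intro exI[of _ ?b]) (simp add: comp_def)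
qed

lemma increasing_bij:
  fixes v :: "'a \<Rightarrow> nat"
  assumes "infinite X" "infinite Y" "inj_on v X" "inj_on v Y"
  shows "\<exists>h. bij_betw h X Y \<and> inc v v (graph_on X h)"
proof -
  obtain b :: "nat \<Rightarrow> 'a" where b: "bij_betw b UNIV X" "\<And>i j. v (b i) < v (b j) \<longleftrightarrow> i < j"
    using increasing_enumeration[OF assms(1,3)] by auto
  obtain c :: "nat \<Rightarrow> 'a" where c: "bij_betw c UNIV Y" "\<And>i j. v (c i) < v (c j) \<longleftrightarrow> i < j"
    using increasing_enumeration[OF assms(2,4)] by auto
  have "bij_betw (c \<circ> inv_into UNIV b) X Y"
    by (rule bij_betw_trans[OF bij_betw_inv_into[OF b(1)] c(1)])
  moreover have "v x < v x' \<longleftrightarrow> v (c (inv_into UNIV b x)) < v (c (inv_into UNIV b x'))"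
    if "x \<in> X" "x' \<in> X" for x x'
  proof -
    have "b (inv_into UNIV b z) = z" if "z \<in> X" for z
      using b(1) that by (auto simp: bij_betw_def f_inv_into_f)
    then show ?thesis using that b(2) c(2) by metis
  qed
  then have "inc v v (graph_on X (c \<circ> inv_into UNIV b))"
    by (intro incI) (auto simp: graph_on_def)
  ultimately show ?thesis by (intro exI[of _ "c \<circ> inv_into UNIV b"] conjI)
qed

text \<open>Inside a countable \<open>W\<close>, increasing bijections carry \<open>X\<close> to
  \<open>Y\<close> and \<open>W - X\<close> to \<open>W - Y\<close>; outside \<open>W\<close> the
  permutation is the identity.\<close>

lemma homogeneous_finc_group:
  assumes L: "infinite L" and v: "coherent_inj L v"
  shows "homogeneous natLeq L (finc_group L v)"
  unfolding homogeneous_def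
proof (intro ballI impI, elim conjE)
  fix X Y
  assume "X \<in> subsets_of_card L natLeq" "Y \<in> subsets_of_card L natLeq"
  then have X: "X \<subseteq> L" "|X| =o natLeq" and Y: "Y \<subseteq> L" "|Y| =o natLeq"
    by (simp_all add: subsets_of_card_def)
  assume co: "|L - X| =o |L|" "|L - Y| =o |L|"
  have omega: "infinite S \<and> countable S" if S: "|S| =o natLeq" for S :: "'a set"
  proof
    show "infinite S"
      using infinite_iff_natLeq_ordLeq ordIso_symmetric[OF S] ordIso_imp_ordLeq by metis
    have "|S| =o |UNIV :: nat set|"
      using S ordIso_symmetric[OF card_of_nat] by (rule ordIso_transitive)
    then obtain f where "bij_betw f S (UNIV :: nat set)" using card_of_ordIso by metis
    then show "countable S" using countableI[of f S] by (simp add: bij_betw_def)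
  qed
  have inf: "infinite (L - X)" "infinite (L - Y)"
    using co L card_of_ordIso_finite by metis+
  \<comment> \<open>\<open>Z\<close> and \<open>Z'\<close> make both complements in \<open>W\<close>
    infinite, so that these too can be matched in type \<omega>.\<close>
  obtain Z where Z: "Z \<subseteq> L - X" "infinite Z" "countable Z"
    using infinite_countable_subset'[OF inf(1)] by (elim exE conjE)
  obtain Z' where Z': "Z' \<subseteq> L - Y" "infinite Z'" "countable Z'"
    using infinite_countable_subset'[OF inf(2)] by (elim exE conjE)
  define W where "W = X \<union> Y \<union> Z \<union> Z'"
  have W: "W \<subseteq> L" "countable W" "X \<subseteq> W" "Y \<subseteq> W"
    using X Y Z Z' omega by (auto simp: W_def)
  have "Z \<subseteq> W - X" "Z' \<subseteq> W - Y" using Z(1) Z'(1) by (auto simp: W_def)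
  then have Winf: "infinite (W - X)" "infinite (W - Y)"
    using Z(2) Z'(2) infinite_super by metis+
  have inj: "inj_on (v W) W" using v W unfolding coherent_inj_def by simp
  have injS: "inj_on (v W) S" if "S \<subseteq> W" for S by (rule inj_on_subset[OF inj that])
  obtain f where f: "bij_betw f X Y" "inc (v W) (v W) (graph_on X f)"
    using increasing_bij[OF _ _ injS[OF W(3)] injS[OF W(4)]] omega X(2) Y(2) by auto
  obtain g where g: "bij_betw g (W - X) (W - Y)" "inc (v W) (v W) (graph_on (W - X) g)"
    using increasing_bij[OF Winf injS injS] by auto
  define p where "p = (\<lambda>x \<in> L. if x \<in> X then f x else if x \<in> W then g x else x)"
  have pX: "p x = f x" if "x \<in> X" for x using that X(1) by (auto simp: p_def)
  have pW: "p x = g x" if "x \<in> W - X" for x using that W(1) by (auto simp: p_def)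
  have pL: "p x = x" if "x \<in> L - W" for x using that W(3) by (auto simp: p_def)
  have bX: "bij_betw p X Y" by (rule bij_betw_cong[OF pX, THEN iffD2, OF _ f(1)])
  have bW: "bij_betw p (W - X) (W - Y)" by (rule bij_betw_cong[OF pW, THEN iffD2, OF _ g(1)])
  have bL: "bij_betw p (L - W) (L - W)"
    by (rule bij_betw_cong[OF pL, THEN iffD2]) (simp_all add: bij_betw_def)
  have "bij_betw p (X \<union> (W - X)) (Y \<union> (W - Y))"
    by (rule bij_betw_combine[OF bX bW]) auto
  moreover have "X \<union> (W - X) = W" "Y \<union> (W - Y) = W" using W by auto
  ultimately have bWW: "bij_betw p W W" by simp
  have "bij_betw p (W \<union> (L - W)) (W \<union> (L - W))"
    by (rule bij_betw_combine[OF bWW bL]) auto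
  moreover have "W \<union> (L - W) = L" using W(1) by auto
  ultimately have "bij_betw p L L" by simp
  then have pB: "p \<in> Bij L" by (simp add: Bij_def p_def)
  have "finc (v S) (v (p ` S)) (graph_on S p)" if S: "S \<subseteq> L" "countable S" for S
  proof -
    \<comment> \<open>The permutation maps \<open>?U\<close> into itself, so one measure
      \<open>v ?U\<close> serves both sides: two increasing pieces on \<open>W\<close>, and the
      identity off \<open>W\<close>. The result is transferred back to \<open>S\<close> and its
      image.\<close>
    let ?U = "S \<union> W"
    have U: "?U \<subseteq> L" "countable ?U" using S W by auto
    have pU: "p x \<in> ?U" if "x \<in> ?U" for x
    proof (cases "x \<in> W")
      case True then show ?thesis using bij_betwE[OF bWW] by auto
    next
      case False then show ?thesis using that pL[of x] S(1) by auto
    qed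
    have "finc (v W) (v W) (graph_on X f \<union> graph_on (W - X) g)"
      by (intro finc_Un inc_imp_finc f g)
    moreover have "graph_on X f \<union> graph_on (W - X) g = graph_on W p"
      using pX pW W(3) by (intro equalityI subrelI) (auto simp: graph_on_iff)
    ultimately have "finc (v W) (v W) (graph_on W p)" by simp
    then have "finc (v ?U) (v ?U) (graph_on W p)"
    proof (rule finc_transfer[OF v _ order_refl])
      show sub: "graph_on W p \<subseteq> W \<times> W" using bij_betwE[OF bWW] by (auto simp: graph_on_iff)
      then show "graph_on W p \<subseteq> ?U \<times> ?U" by blast
    qed (use U W in simp_all)
    moreover have "finc (v ?U) (v ?U) (Id_on ?U)"
      using v U unfolding coherent_inj_def by (metis inf_idem)
    ultimately have "finc (v ?U) (v ?U) (graph_on W p \<union> Id_on ?U)" by (rule finc_Un)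
    moreover have "graph_on S p \<subseteq> graph_on W p \<union> Id_on ?U"
    proof (rule subrelI)
      fix x z assume "(x, z) \<in> graph_on S p"
      then have x: "x \<in> S" "z = p x" by (simp_all add: graph_on_iff)
      then show "(x, z) \<in> graph_on W p \<union> Id_on ?U"
        using pL[of x] S(1) by (cases "x \<in> W") (auto simp: graph_on_iff)
    qed
    ultimately show ?thesis
    proof (rule finc_transfer[OF v])
      show "p ` S \<subseteq> L" by (rule Bij_image_subset[OF pB S(1)])
      show "graph_on S p \<subseteq> ?U \<times> ?U"
      proof (rule subrelI)
        fix x z assume "(x, z) \<in> graph_on S p"
        then have "x \<in> ?U" "z = p x" by (simp_all add: graph_on_iff)
        then show "(x, z) \<in> ?U \<times> ?U" using pU[of x] by (intro SigmaI) simp_all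
      qed
      show "graph_on S p \<subseteq> S \<times> p ` S" by (auto simp: graph_on_iff)
    qed (use U S in simp_all)
  qed
  then have "p \<in> finc_group L v" using pB by (simp add: finc_group_def)
  moreover have "p ` X = Y" using bX by (simp add: bij_betw_def)
  ultimately show "\<exists>g \<in> finc_group L v. g ` X = Y" by (intro bexI[of _ p])
qed

section \<open>Intransitivity\<close>

text \<open>The involution reversing each block \<open>{2\<^sup>k..<2\<^sup>k\<^sup>+\<^sup>1}\<close>.\<close>

definition block_reversal :: "(nat \<times> nat) set" where
  "block_reversal = {(i, j). \<exists>k. 2 ^ k \<le> i \<and> i < 2 * 2 ^ k \<and> i + j + 1 = 3 * 2 ^ k}"

lemma block_unique:
  fixes i :: nat
  assumes "2 ^ k \<le> i" "i < 2 * 2 ^ k" "2 ^ l \<le> i" "i < 2 * 2 ^ l"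
  shows "k = l"
proof -
  have le: "k \<le> l" if "2 ^ k \<le> i" "i < 2 * 2 ^ l" for k l
  proof -
    have "(2 :: nat) ^ k < 2 ^ Suc l" using that by simp
    then have "k < Suc l" by (rule power_less_imp_less_exp[rotated]) simp
    then show ?thesis by simp
  qed
  show ?thesis using le[OF assms(1,4)] le[OF assms(3,2)] by simp
qed

lemma block_reversal_sym: "block_reversal\<inverse> = block_reversal"
proof -
  have "(j, i) \<in> block_reversal" if ij: "(i, j) \<in> block_reversal" for i j
  proof -
    obtain k where "2 ^ k \<le> i" "i < 2 * 2 ^ k" "i + j + 1 = 3 * 2 ^ k"
      using ij by (auto simp: block_reversal_def)
    then have "2 ^ k \<le> j \<and> j < 2 * 2 ^ k \<and> j + i + 1 = 3 * 2 ^ k" by linarith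
    then show ?thesis by (auto simp: block_reversal_def)
  qed
  then show ?thesis by auto
qed

lemma block_reversal_single_valued: "single_valued block_reversal"
proof (rule single_valuedI)
  fix i j j' assume "(i, j) \<in> block_reversal" "(i, j') \<in> block_reversal"
  then obtain k l where *: "2 ^ k \<le> i" "i < 2 * 2 ^ k" "i + j + 1 = 3 * 2 ^ k"
      "2 ^ l \<le> i" "i < 2 * 2 ^ l" "i + j' + 1 = 3 * 2 ^ l"
    by (auto simp: block_reversal_def)
  then have "k = l" using block_unique by metis
  then show "j = j'" using * by simp
qed

text \<open>An increasing relation meets each block in at most one point.\<close>

lemma block_reversal_not_finc: "\<not> finc id id block_reversal"
proof
  assume "finc id id block_reversal"
  then obtain Q where Q: "finite Q" "block_reversal = \<Union>Q" "\<And>q. q \<in> Q \<Longrightarrow> inc id id q"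
    unfolding finc_def by auto
  \<comment> \<open>The block with this index has \<open>2 ^ k > card Q\<close> points, so two of
    them fall into the same increasing piece, although the reversal exchanges their order.\<close>
  define k where "k = card Q"
  define I where "I = {2 ^ k..<2 * 2 ^ k :: nat}"
  let ?r = "\<lambda>i. 3 * 2 ^ k - 1 - i"
  have "\<exists>q \<in> Q. (i, ?r i) \<in> q" if "i \<in> I" for i
  proof -
    have "(i, ?r i) \<in> block_reversal"
      using that by (auto simp: block_reversal_def I_def intro!: exI[of _ k])
    then show ?thesis using Q(2) by auto
  qed
  then obtain c where c: "\<And>i. i \<in> I \<Longrightarrow> c i \<in> Q \<and> (i, ?r i) \<in> c i" by metis
  have "inj_on c I"
  proof (rule linorder_inj_onI')
    fix i j assume ij: "i \<in> I" "j \<in> I" "i < j"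
    show "c i \<noteq> c j"
    proof
      assume "c i = c j"
      then have "?r i < ?r j"
        using incD[OF Q(3), of "c i" i "?r i" j "?r j"] c[OF ij(1)] c[OF ij(2)] ij(3) by simp
      then show False using ij by (auto simp: I_def)
    qed
  qed
  then have "card I \<le> card Q" by (rule card_inj_on_le) (use c Q(1) in auto)
  moreover have "card Q < card I" using less_exp[of k] by (simp add: I_def k_def)
  ultimately show False by simp
qed

text \<open>Two disjoint copies of \<open>L\<close> fit into \<open>L\<close>; a countable infinite
  set taken from one copy leaves the other in its complement.\<close>

lemma infinite_split:
  assumes "infinite L"
  shows "\<exists>A \<subseteq> L. infinite A \<and> countable A \<and> |L - A| =o |L|"
proof -
  have "|L <+> L| =o |L|"
    using card_of_Plus_infinite1[OF assms, of L] card_of_refl ordIso_imp_ordLeq by metis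
  then obtain h where h: "bij_betw h (L <+> L) L" using card_of_ordIso by metis
  then have inj: "inj_on h (L <+> L)" and sub: "h ` (L <+> L) \<subseteq> L"
    by (auto simp: bij_betw_def)
  have injl: "inj_on (\<lambda>x. h (Inl x)) L" and injr: "inj_on (\<lambda>x. h (Inr x)) L"
    using inj by (auto simp: inj_on_def)
  have "infinite ((\<lambda>x. h (Inl x)) ` L)" using injl assms finite_imageD by blast
  then obtain A where A: "A \<subseteq> (\<lambda>x. h (Inl x)) ` L" "infinite A" "countable A"
    using infinite_countable_subset' by metis
  have AL: "A \<subseteq> L" using A(1) sub by auto
  have "h (Inr x) \<in> L - A" if "x \<in> L" for x
  proof -
    have "h (Inr x) \<noteq> h (Inl y)" if "y \<in> L" for y
      using inj_onD[OF inj, of "Inr x" "Inl y"] \<open>x \<in> L\<close> that by auto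
    then show ?thesis using that sub A(1) by auto
  qed
  then have "|L| \<le>o |L - A|" by (rule card_of_ordLeqI[OF injr])
  moreover have "|L - A| \<le>o |L|" by (rule card_of_mono1) auto
  ultimately have "|L - A| =o |L|" by (simp add: ordIso_iff_ordLeq)
  then show ?thesis using A(2,3) AL by (intro exI[of _ A]) simp
qed

text \<open>The block reversal is copied to a countable set \<open>A\<close>. Each group element
  meets this copy in a \<open>finc\<close> relation, so finitely many of them cannot cover it up to
  a finite remainder.\<close>

lemma intransitive_finc_group:
  fixes L :: "'a set"
  assumes L: "infinite L" and v: "coherent_inj L v"
  shows "intransitive natLeq L (finc_group L v)"
proof -
  obtain A where A: "A \<subseteq> L" "infinite A" "countable A" "|L - A| =o |L|"
    using infinite_split[OF L] by auto
  have inj: "inj_on (v A) A" using v A unfolding coherent_inj_def by simp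
  obtain b :: "nat \<Rightarrow> 'a" where b: "bij_betw b UNIV A" "\<And>i j. v A (b i) < v A (b j) \<longleftrightarrow> i < j"
    using increasing_enumeration[OF A(2) inj] by auto
  have injb: "inj b" and rb: "range b = A" using b(1) by (auto simp: bij_betw_def)
  define y where "y = map_prod b b ` block_reversal"
  have ysym: "y\<inverse> = y"
  proof -
    have "y\<inverse> = map_prod b b ` (block_reversal\<inverse>)" by (force simp: y_def)
    then show ?thesis by (simp add: block_reversal_sym y_def)
  qed
  have sv: "single_valued y"
  proof (rule single_valuedI)
    fix x z z' assume "(x, z) \<in> y" "(x, z') \<in> y"
    then obtain i j i' j' where *: "(i, j) \<in> block_reversal" "(i', j') \<in> block_reversal"
        "x = b i" "z = b j" "x = b i'" "z' = b j'"
      by (auto simp: y_def)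
    then have "i = i'" using injb by (auto dest: injD)
    then show "z = z'" using * single_valuedD[OF block_reversal_single_valued] by blast
  qed
  have yA: "y \<subseteq> A \<times> A" using rb by (auto simp: y_def)
  have nf: "\<not> finc (v A) (v A) y"
  proof
    assume *: "finc (v A) (v A) y"
    \<comment> \<open>The graph of \<open>b\<close> is increasing. Conjugating \<open>y\<close> by
      it recovers the block reversal on the natural numbers.\<close>
    have G: "finc id (v A) (range (\<lambda>i. (i, b i)))"
      by (intro inc_imp_finc incI) (auto simp: b(2))
    have "finc id id (range (\<lambda>i. (i, b i)) O (y O (range (\<lambda>i. (i, b i)))\<inverse>))"
      by (intro finc_relcomp[OF G finc_relcomp[OF * finc_converse[OF G]]])
    moreover have "block_reversal \<subseteq> range (\<lambda>i. (i, b i)) O (y O (range (\<lambda>i. (i, b i)))\<inverse>)"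
      by (force simp: y_def)
    ultimately show False using block_reversal_not_finc finc_subset by metis
  qed
  then have yinf: "infinite y" using finc_finite by metis
  have ycnt: "countable y" unfolding y_def by (rule countable_image) (rule countableI_type)
  have omega: "|S| =o natLeq" if "infinite S" "countable S" for S :: "'b set"
  proof -
    have "bij_betw (to_nat_on S) S UNIV" using that by (simp add: to_nat_on_infinite)
    then have "|S| =o |UNIV :: nat set|" by (rule card_of_ordIsoI)
    then show ?thesis using card_of_nat by (rule ordIso_transitive)
  qed
  have large: "large (graph_on L ` finc_group L v) y"
    unfolding large_def
  proof (intro allI impI, elim conjE)
    fix H assume H: "finite H" "H \<subseteq> graph_on L ` finc_group L v"
    \<comment> \<open>The group condition measures the target by the image of \<open>A\<close> under
      \<open>g\<close>; since \<open>y\<close> stays inside \<open>A\<close>, it can be measured by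
      \<open>v A\<close> on both sides.\<close>
    have "finc (v A) (v A) (y \<inter> h)" if h: "h \<in> H" for h
    proof -
      obtain g where g: "g \<in> finc_group L v" "h = graph_on L g" using H(2) h by auto
      have "finc (v A) (v (g ` A)) (graph_on A g)" by (rule finc_groupD(2)[OF g(1) A(1,3)])
      moreover have sub: "y \<inter> h \<subseteq> graph_on A g" using yA g(2) by (auto simp: graph_on_iff)
      ultimately show ?thesis
      proof (rule finc_transfer[OF v])
        show "y \<inter> h \<subseteq> A \<times> g ` A" using sub by (auto simp: graph_on_iff)
        show "y \<inter> h \<subseteq> A \<times> A" using yA by auto
        show "g ` A \<subseteq> L" by (rule Bij_image_subset[OF finc_groupD(1)[OF g(1)] A(1)])
      qed (use A in simp_all)
    qed
    then have cov: "finc (v A) (v A) (\<Union>h \<in> H. y \<inter> h)" by (rule finc_UN[OF H(1)])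
    have "infinite (y - \<Union>H)"
    proof
      assume "finite (y - \<Union>H)"
      then have "finc (v A) (v A) ((y - \<Union>H) \<union> (\<Union>h \<in> H. y \<inter> h))"
        by (rule finc_Un[OF finc_finite cov])
      moreover have "(y - \<Union>H) \<union> (\<Union>h \<in> H. y \<inter> h) = y" by auto
      ultimately show False using nf by simp
    qed
    then have "|y - \<Union>H| =o natLeq" using ycnt by (intro omega) auto
    moreover have "natLeq =o |y|" by (rule ordIso_symmetric[OF omega[OF yinf ycnt]])
    ultimately show "|y - \<Union>H| =o |y|" by (rule ordIso_transitive)
  qed
  \<comment> \<open>As \<open>y\<close> is an involution, domain and range coincide, and
    single-valuedness of \<open>y\<close> is also its injectivity.\<close>
  have DR: "Range y = Domain y" using ysym by (metis Domain_converse)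
  have DA: "Domain y \<subseteq> A" using yA by auto
  have "infinite (Domain y)"
  proof
    assume "finite (Domain y)"
    then have "finite (Domain y \<times> Range y)" using DR by simp
    moreover have "y \<subseteq> Domain y \<times> Range y" by auto
    ultimately show False using yinf finite_subset by metis
  qed
  then have "|Domain y| =o natLeq" using countable_subset[OF DA A(3)] by (rule omega)
  then have dom: "Domain y \<union> Range y \<in> subsets_of_card L natLeq"
    using DA A(1) DR by (simp add: subsets_of_card_def)
  have "|L| \<le>o |L - Domain y|"
    using ordIso_ordLeq_trans[OF ordIso_symmetric[OF A(4)] card_of_mono1[of "L - A" "L - Domain y"]] DA
    by auto
  moreover have "|L - Domain y| \<le>o |L|" by (rule card_of_mono1) auto
  ultimately have "|L - Domain y| =o |L|" by (simp add: ordIso_iff_ordLeq)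
  then show ?thesis
    unfolding intransitive_def using sv ysym large dom DR by (intro exI[of _ y]) simp
qed

theorem theorem2p5:
  fixes lam :: "'a rel"
  assumes "Card_order lam" and "infinite (Field lam)"
    and "below_aleph_omega lam \<or>
         (ctwo ^c natLeq <o lam \<and>
          (\<forall>\<mu> :: 'a rel. Card_order \<mu> \<and> \<mu> \<le>o lam \<and> cf \<mu> =o natLeq \<and> natLeq <o \<mu> \<longrightarrow>
             \<mu> ^c natLeq =o cardSuc \<mu> \<and> square \<mu>))"
  shows "\<exists>G. permutation_group (Field lam) G \<and>
             homogeneous natLeq (Field lam) G \<and>
             intransitive natLeq (Field lam) G"
proof -
  obtain E :: "('a set \<times> ('a \<Rightarrow> nat)) set" where "coherent E" "full (Field lam) E"
    using full_coherent_exists[OF assms(1)] assms(3) by auto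
  then obtain v where v: "coherent_inj (Field lam) v" using coherent_inj_exists by blast
  then show ?thesis
    using permutation_group_finc_group homogeneous_finc_group[OF assms(2)]
      intransitive_finc_group[OF assms(2)]
    by (intro exI[of _ "finc_group (Field lam) v"] conjI) simp_all
qed

end
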